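(* Let $X$ be a (nonempty) compact Hausdorff space, $\alpha:X\to X$ a continuous map that is a finite-sheeted cover on $X_\alpha$, i.e. $\sup_{x\in X_\alpha}|\alpha^{-1}(x)\cap X_\alpha|<\infty$, and $A:C(X)\to C(X)$ an $X_\alpha$-compatible transfer operator for $(X,\alpha)$ with cocycle $\rho$. Suppose that the inverse rami-rate is zero, $\omega(\alpha)=0$, and that $\rho$ is continuous on $X_\alpha$ (in particular, both conditions hold when $\alpha$ is a homeomorphism on $X_\alpha$). Then for every $\mu\in M_\alpha(X)$ $$\tau(\mu)=\int_{X_\alpha}\ln\rho\,d\mu.$$
   Context: A transfer operator for $(X,\alpha)$ is a positive linear operator $A:C(X)\to C(X)$ with $A((f\circ\alpha)g)=f\,Ag$ for all $f,g\in C(X)$. $M_\alpha(X)$ is the set of regular Borel $\alpha$-invariant probability measures on $X$; $\mu[f]=\int f\,d\mu$. Convention $\ln0=-\infty$; integrals of logarithms take values in $[-\infty,\infty)$. A point $x\in X$ is essential if every neighborhood $V$ of $x$ satisfies $\mu(V)>0$ for some $\mu\in M_\alpha(X)$; $X_\alpha$ is the (closed) set of essential points; $\alpha(X_\alpha)=X_\alpha$ and every $\mu\in M_\alpha(X)$ is supported in $X_\alpha$. For $x\in X_\alpha$ put $\tilde\alpha^{-n}(x):=\alpha^{-n}(x)\cap X_\alpha$. Inverse rami-rate: $\omega(\alpha):=\ln\limsup_{n\to\infty}\sup_{x\in X_\alpha}|\tilde\alpha^{-n}(x)|^{1/n}$. Compatibility and cocycle: for $x\in X$ let $\nu_x$ be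 the regular Borel measure (possibly $0$) with $\int f\,d\nu_x=[Af](x)$ for $f\in C(X)$; its support lies in $\alpha^{-1}(x)$. $A$ is $X_\alpha$-compatible if for every $f\in C(X_\alpha)$ the function $x\mapsto\int_{X_\alpha}f\,d\nu_x$ is continuous on $X_\alpha$; then $[A_{X_\alpha}f](x):=\int_{X_\alpha}f\,d\nu_x$ defines a transfer operator on $C(X_\alpha)$. It has the form $[A_{X_\alpha}f](x)=\sum_{y\in\tilde\alpha^{-1}(x)}\rho(y)f(y)$, where $\rho(y)=\nu_{\alpha(y)}(\{y\})\ge0$, $y\in X_\alpha$; $\rho$ is called the cocycle. $t$-entropy: for $\mu\in M_\alpha(X)$, $$\tau(\mu):=\inf_{n\in\mathbb N}\frac1n\inf_G\sum_{g\in G}\mu[g]\ln\frac{\mu[A^ng]}{\mu[g]},$$ where $G$ runs over all (finite) continuous partitions of unity in $C(X)$ by nonnegative functions and a summand with $\mu[g]=0$ is set equal to $0$. *)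

theory Defs
  imports "HOL-Probability.Probability_Measure"
begin

text \<open>
  The compact Hausdorff space \<open>X\<close> is a whole type \<open>'a\<close> of class \<^class>\<open>t2_space\<close>; its compactness is
  an explicit assumption wherever it is needed. \<open>C(X)\<close> is the set of \<open>f :: 'a \<Rightarrow> real\<close> with
  \<^term>\<open>continuous_on UNIV f\<close>, and an operator on \<open>C(X)\<close> is a map on all functions whose values on
  discontinuous functions are irrelevant.
\<close>

definition transfer_operator ::
    "('a::t2_space \<Rightarrow> 'a) \<Rightarrow> (('a \<Rightarrow> real) \<Rightarrow> ('a \<Rightarrow> real)) \<Rightarrow> bool" where
  "transfer_operator \<alpha> A \<longleftrightarrow>
     (\<forall>f. continuous_on UNIV f \<longrightarrow> continuous_on UNIV (A f)) \<and>
     (\<forall>f g. continuous_on UNIV f \<longrightarrow> continuous_on UNIV g \<longrightarrow>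
        A (\<lambda>x. f x + g x) = (\<lambda>x. A f x + A g x)) \<and>
     (\<forall>c f. continuous_on UNIV f \<longrightarrow> A (\<lambda>x. c * f x) = (\<lambda>x. c * A f x)) \<and>
     (\<forall>f. continuous_on UNIV f \<longrightarrow> (\<forall>x. 0 \<le> f x) \<longrightarrow> (\<forall>x. 0 \<le> A f x)) \<and>
     (\<forall>f g. continuous_on UNIV f \<longrightarrow> continuous_on UNIV g \<longrightarrow>
        A (\<lambda>x. f (\<alpha> x) * g x) = (\<lambda>x. f x * A g x))"

definition regular_borel_measure :: "'a::t2_space measure \<Rightarrow> bool" where
  "regular_borel_measure M \<longleftrightarrow>
     sets M = sets borel \<and> finite_measure M \<and>
     (\<forall>B\<in>sets borel.
        emeasure M B = (SUP K\<in>{K. compact K \<and> K \<subseteq> B}. emeasure M K) \<and>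
        emeasure M B = (INF U\<in>{U. open U \<and> B \<subseteq> U}. emeasure M U))"

definition invariant_measures :: "('a::t2_space \<Rightarrow> 'a) \<Rightarrow> 'a measure set" where
  "invariant_measures \<alpha> =
     {\<mu>. regular_borel_measure \<mu> \<and> prob_space \<mu> \<and> distr \<mu> borel \<alpha> = \<mu>}"

definition essential_points :: "('a::t2_space \<Rightarrow> 'a) \<Rightarrow> 'a set" where
  "essential_points \<alpha> =
     {x. \<forall>V. open V \<longrightarrow> x \<in> V \<longrightarrow> (\<exists>\<mu>\<in>invariant_measures \<alpha>. emeasure \<mu> V > 0)}"

definition essential_preimage :: "('a::t2_space \<Rightarrow> 'a) \<Rightarrow> nat \<Rightarrow> 'a \<Rightarrow> 'a set" where
  "essential_preimage \<alpha> n x = {y \<in> essential_points \<alpha>. (\<alpha> ^^ n) y = x}"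

text \<open>
  Sizes of preimages are taken in \<^typ>\<open>ereal\<close>, so that an infinite preimage counts as \<open>\<infinity>\<close> and not
  as \<open>0\<close>.
\<close>

definition finite_sheeted_on_essential :: "('a::t2_space \<Rightarrow> 'a) \<Rightarrow> bool" where
  "finite_sheeted_on_essential \<alpha> \<longleftrightarrow>
     (SUP x\<in>essential_points \<alpha>.
        if finite (essential_preimage \<alpha> 1 x)
        then ereal (real (card (essential_preimage \<alpha> 1 x))) else \<infinity>) < \<infinity>"

definition eln :: "ereal \<Rightarrow> ereal" where
  "eln x = (if x \<le> 0 then -\<infinity> else if x = \<infinity> then \<infinity> else ereal (ln (real_of_ereal x)))"

definition inverse_rami_rate :: "('a::t2_space \<Rightarrow> 'a) \<Rightarrow> ereal" where
  "inverse_rami_rate \<alpha> =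
     eln (limsup (\<lambda>n. SUP x\<in>essential_points \<alpha>.
        if finite (essential_preimage \<alpha> n x)
        then ereal (root n (real (card (essential_preimage \<alpha> n x)))) else \<infinity>))"

definition operator_measure ::
    "(('a::t2_space \<Rightarrow> real) \<Rightarrow> ('a \<Rightarrow> real)) \<Rightarrow> 'a \<Rightarrow> 'a measure" where
  "operator_measure A x =
     (THE \<nu>. regular_borel_measure \<nu> \<and>
        (\<forall>f. continuous_on UNIV f \<longrightarrow> integral\<^sup>L \<nu> f = A f x))"

definition essentially_compatible ::
    "('a::t2_space \<Rightarrow> 'a) \<Rightarrow> (('a \<Rightarrow> real) \<Rightarrow> ('a \<Rightarrow> real)) \<Rightarrow> bool" where
  "essentially_compatible \<alpha> A \<longleftrightarrow>
     (\<forall>f :: 'a \<Rightarrow> real. continuous_on (essential_points \<alpha>) f \<longrightarrow>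
        continuous_on (essential_points \<alpha>)
          (\<lambda>x. set_lebesgue_integral (operator_measure A x) (essential_points \<alpha>) f))"

definition cocycle ::
    "('a::t2_space \<Rightarrow> 'a) \<Rightarrow> (('a \<Rightarrow> real) \<Rightarrow> ('a \<Rightarrow> real)) \<Rightarrow> 'a \<Rightarrow> real" where
  "cocycle \<alpha> A y = measure (operator_measure A (\<alpha> y)) {y}"

definition partitions_of_unity :: "('a::t2_space \<Rightarrow> real) set set" where
  "partitions_of_unity =
     {G. finite G \<and> (\<forall>g\<in>G. continuous_on UNIV g \<and> (\<forall>x. 0 \<le> g x)) \<and> (\<forall>x. (\<Sum>g\<in>G. g x) = 1)}"

definition t_entropy ::
    "(('a::t2_space \<Rightarrow> real) \<Rightarrow> ('a \<Rightarrow> real)) \<Rightarrow> 'a measure \<Rightarrow> ereal" where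
  "t_entropy A \<mu> =
     (INF n\<in>{1::nat..}. ereal (1 / real n) *
        (INF G\<in>partitions_of_unity. \<Sum>g\<in>G.
           if integral\<^sup>L \<mu> g = 0 then 0
           else ereal (integral\<^sup>L \<mu> g) * eln (ereal (integral\<^sup>L \<mu> ((A ^^ n) g) / integral\<^sup>L \<mu> g))))"

text \<open>
  The integral of an extended real function as the integral of its positive part minus that of its
  negative part (\<^const>\<open>e2ennreal\<close> sends negative values to \<open>0\<close>). It is meaningful when one of the
  two is finite, as for logarithms of bounded functions.
\<close>

definition extended_set_integral :: "'a measure \<Rightarrow> 'a set \<Rightarrow> ('a \<Rightarrow> ereal) \<Rightarrow> ereal" where
  "extended_set_integral M S f =
     enn2ereal (\<integral>\<^sup>+x\<in>S. e2ennreal (f x) \<partial>M) - enn2ereal (\<integral>\<^sup>+x\<in>S. e2ennreal (- f x) \<partial>M)"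

end

(*
  Lower bound: A^n g(alpha^n y) >= rho(y) ... rho(alpha^(n-1) y) g(y), so invariance of mu and
  Jensen's inequality bound every sum in the definition of tau from below by n times the integral
  of ln rho.

  Upper bound: if psi oscillates little on the support of each member of the partition of unity G,
  the entropy sum of G is at most mu[psi] + ln mu[A^n exp(-psi)] up to a small error. Take for psi
  the Birkhoff sum of -ln w, where w equals 1 / max(rho, e) on the essential set and is tiny away
  from it. Then A^n exp(-psi) is the n-th iterate of f |-> A(w f) at 1, which on the essential
  set is bounded by the number of n-th essential preimages plus a small leak; that number grows
  subexponentially because the rami-rate vanishes. Monotone convergence lets e tend to 0.

  The measures nu_x come from the Riesz representation theorem. The essential set is nonempty
  because invariant measures exist (a cluster point of Birkhoff averages).
*)
theory Submission
  imports Defs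
begin

section \<open>The Riesz representation theorem on a compact space\<close>

text \<open>The obstacle in the upper bound is that A and the partitions of unity live on all of X,
  while preimages are counted only in X_\<alpha>, and a measure nu_x may charge the part of the
  fibre outside X_\<alpha>. The weight is therefore a quotient h / s: s extends max(rho, e)
  continuously with s \<ge> e everywhere, and h is a cutoff whose integral against nu_x exceeds
  nu_x(X_\<alpha>) by at most d, uniformly over essential x. Truncation at e keeps the logarithm of
  the weight finite and continuous where rho vanishes; for the same reason h is strictly positive.
  The leak constant grows with n, but tau is an infimum over n, so one n serves for each accuracy,
  and d, h and the weight may depend on it. Both entropy bounds come from ln t \<le> t - 1: from
  above in a form affine in the masses, which can be summed over G, and from below as a tangent to
  ln integrated against each member of G. X may fail to be metrizable; regularity of the measures
  takes the place of countable approximation, and cluster points in a product of intervals that of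
  convergent subsequences.\<close>

lemma compact_space_normal:
  assumes "compact (UNIV :: 'a::t2_space set)"
  shows "normal_space (euclidean :: 'a topology)"
proof (rule compact_Hausdorff_or_regular_imp_normal_space)
  show "compact_space (euclidean :: 'a topology)" using assms by (simp add: compact_space_def)
  have "Hausdorff_space (euclidean :: 'a topology)"
    unfolding Hausdorff_space_def disjnt_def using hausdorff by auto
  then show "Hausdorff_space (euclidean :: 'a topology) \<or> regular_space (euclidean :: 'a topology)" ..
qed

lemma urysohn_compact:
  assumes "compact (UNIV :: 'a::t2_space set)" "closed S" "closed T" "S \<inter> T = {}"
  obtains f :: "'a::t2_space \<Rightarrow> real" where "continuous_on UNIV f" "\<And>x. 0 \<le> f x" "\<And>x. f x \<le> 1"
    "\<And>x. x \<in> S \<Longrightarrow> f x = 0" "\<And>x. x \<in> T \<Longrightarrow> f x = 1"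
proof -
  obtain f where f: "continuous_map euclidean (top_of_set {0..1::real}) f" "f ` S \<subseteq> {0}" "f ` T \<subseteq> {1}"
    using Urysohn_lemma[of euclidean S T 0 1] compact_space_normal[OF assms(1)] assms(2-4)
    by (auto simp: disjnt_def)
  from f(1) have "continuous_on UNIV f" "\<And>x. 0 \<le> f x \<and> f x \<le> 1"
    by (auto simp: continuous_map_in_subtopology image_subset_iff)
  with f(2,3) that show thesis by (metis image_subset_iff singletonD)
qed

lemma compact_eq_closed_compact_space:
  assumes "compact (UNIV :: 'a::t2_space set)"
  shows "compact K \<longleftrightarrow> closed (K :: 'a set)"
  using assms compact_imp_closed by (metis compact_Int_closed inf_top_left)

text \<open>One locale serves three functionals: the limit of orbit averages that yields an
  invariant measure, f \<mapsto> A f x for the measures nu_x, and f \<mapsto> mu[A^n f] in the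
  entropy bound. The axioms speak of continuous functions only, since operators are total maps with
  arbitrary values elsewhere.\<close>

locale positive_functional =
  fixes L :: "('a::t2_space \<Rightarrow> real) \<Rightarrow> real"
  assumes compact_UNIV: "compact (UNIV :: 'a set)"
    and add: "continuous_on UNIV f \<Longrightarrow> continuous_on UNIV g \<Longrightarrow> L (\<lambda>x. f x + g x) = L f + L g"
    and scale: "continuous_on UNIV f \<Longrightarrow> L (\<lambda>x. c * f x) = c * L f"
    and nonneg: "continuous_on UNIV f \<Longrightarrow> (\<And>x. 0 \<le> f x) \<Longrightarrow> 0 \<le> L f"
begin

lemma diff:
  assumes "continuous_on UNIV f" "continuous_on UNIV g"
  shows "L (\<lambda>x. f x - g x) = L f - L g"
  using add[OF assms(1), of "\<lambda>x. -1 * g x"] scale[OF assms(2), of "-1"] assms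
  by (simp add: continuous_on_minus)

lemma mono:
  assumes "continuous_on UNIV f" "continuous_on UNIV g" "\<And>x. f x \<le> g x"
  shows "L f \<le> L g"
  using nonneg[of "\<lambda>x. g x - f x"] diff[OF assms(2,1)] assms by (simp add: continuous_on_diff)

lemma const: "L (\<lambda>x. c) = c * L (\<lambda>x. 1)"
  using scale[of "\<lambda>x. 1" c] by simp

lemma sum:
  assumes "finite I" "\<And>i. i \<in> I \<Longrightarrow> continuous_on UNIV (f i)"
  shows "L (\<lambda>x. \<Sum>i\<in>I. f i x) = (\<Sum>i\<in>I. L (f i))"
  using assms
proof (induction rule: finite_induct)
  case empty
  then show ?case using const[of 0] by simp
next
  case (insert i I)
  then show ?case by (simp add: add continuous_on_sum)
qed

text \<open>Support inside V is deliberately not demanded, only vanishing off V; the cutoff max 0 (f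
  - e) recovers it where compactness is needed.\<close>

definition below :: "'a set \<Rightarrow> ('a \<Rightarrow> real) set" where
  "below V = {f. continuous_on UNIV f \<and> (\<forall>x. 0 \<le> f x \<and> f x \<le> indicator V x)}"

definition content :: "'a set \<Rightarrow> ennreal" where
  "content V = (SUP f\<in>below V. ennreal (L f))"

definition outer :: "'a set \<Rightarrow> ennreal" where
  "outer E = (INF V\<in>{V. open V \<and> E \<subseteq> V}. content V)"

lemma belowI:
  assumes "continuous_on UNIV f" "\<And>x. 0 \<le> f x" "\<And>x. f x \<le> 1" "\<And>x. x \<notin> V \<Longrightarrow> f x = 0"
  shows "f \<in> below V"
  using assms by (auto simp: below_def indicator_def)

lemma belowD:
  assumes "f \<in> below V"
  shows "continuous_on UNIV f" "0 \<le> f x" "f x \<le> 1" "x \<notin> V \<Longrightarrow> f x = 0" "f x > 0 \<Longrightarrow> x \<in> V"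
proof -
  have *: "continuous_on UNIV f" "0 \<le> f x" "f x \<le> indicator V x"
    using assms by (auto simp: below_def)
  show "continuous_on UNIV f" "0 \<le> f x" by fact+
  show "f x \<le> 1" "x \<notin> V \<Longrightarrow> f x = 0" "f x > 0 \<Longrightarrow> x \<in> V"
    using * by (cases "x \<in> V"; auto)+
qed

lemma le_content: "f \<in> below V \<Longrightarrow> ennreal (L f) \<le> content V"
  unfolding content_def by (rule SUP_upper)

lemma content_le_total: "content V \<le> ennreal (L (\<lambda>x. 1))"
  unfolding content_def
  by (intro SUP_least ennreal_leI mono) (auto dest: belowD)

lemma content_mono: "V \<subseteq> W \<Longrightarrow> content V \<le> content W"
  unfolding content_def
  by (rule SUP_subset_mono) (force intro!: belowI dest: belowD)+

lemma outer_mono: "E \<subseteq> F \<Longrightarrow> outer E \<le> outer F"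
  unfolding outer_def by (rule INF_superset_mono) auto

lemma outer_open: "open V \<Longrightarrow> outer V = content V"
  unfolding outer_def
  by (intro antisym INF_greatest INF_lower content_mono) auto

lemma outer_le: "open V \<Longrightarrow> E \<subseteq> V \<Longrightarrow> outer E \<le> content V"
  unfolding outer_def by (rule INF_lower) auto

lemma outer_less_top: "outer E < \<infinity>"
  using outer_le[OF open_UNIV, of E] content_le_total[of UNIV]
  by (metis ennreal_less_top infinity_ennreal_def order_le_less_trans subset_UNIV)

lemma content_empty: "content {} = 0"
proof -
  have "L f \<le> 0" if "f \<in> below {}" for f
  proof -
    have "f = (\<lambda>x. 0)" using belowD(4)[OF that] by auto
    then show ?thesis using const[of 0] by simp
  qed
  then show ?thesis
    by (auto simp: content_def ennreal_neg intro!: antisym SUP_least)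
qed

text \<open>Cutting off at a small height makes the support compact inside the open set.\<close>

lemma content_leI:
  assumes "\<And>f e. f \<in> below V \<Longrightarrow> 0 < e \<Longrightarrow> ennreal (L (\<lambda>x. max 0 (f x - e))) \<le> B"
  shows "content V \<le> B"
  unfolding content_def
proof (rule SUP_least)
  fix f assume f: "f \<in> below V"
  note fc = belowD(1)[OF f]
  show "ennreal (L f) \<le> B"
  proof (rule ennreal_le_epsilon)
    fix e :: real assume "0 < e"
    define c where "c = L (\<lambda>x. 1)"
    have c: "0 \<le> c" unfolding c_def by (rule nonneg) auto
    \<comment> \<open>The + 1 keeps the quotient meaningful when the total mass c is 0.\<close>
    define d where "d = e / (c + 1)"
    have d: "0 < d" "d * c \<le> e" using \<open>0 < e\<close> c by (auto simp: d_def field_simps)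
    have cut: "continuous_on UNIV (\<lambda>x. max 0 (f x - d))" using fc by (intro continuous_intros)
    have "L f \<le> L (\<lambda>x. max 0 (f x - d) + d)"
      by (rule mono) (use fc cut in \<open>auto intro!: continuous_intros\<close>)
    also have "\<dots> = L (\<lambda>x. max 0 (f x - d)) + d * c"
      using add[OF cut, of "\<lambda>x. d"] const[of d] by (simp add: c_def)
    also have "\<dots> \<le> L (\<lambda>x. max 0 (f x - d)) + e" using d by simp
    finally have "ennreal (L f) \<le> ennreal (L (\<lambda>x. max 0 (f x - d)) + e)" by (rule ennreal_leI)
    also have "\<dots> = ennreal (L (\<lambda>x. max 0 (f x - d))) + ennreal e"
      using \<open>0 < e\<close> by (intro ennreal_plus nonneg cut) auto
    also have "\<dots> \<le> B + ennreal e"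
      by (intro add_mono assms f d) simp
    finally show "ennreal (L f) \<le> B + ennreal e" .
  qed
qed

lemma cut_below:
  assumes "f \<in> below V" "0 < e" "{x. e \<le> f x} \<subseteq> W"
  shows "(\<lambda>x. max 0 (f x - e)) \<in> below W"
proof (rule belowI)
  show "continuous_on UNIV (\<lambda>x. max 0 (f x - e))"
    using belowD(1)[OF assms(1)] by (intro continuous_intros)
  show "max 0 (f x - e) \<le> 1" for x using belowD(3)[OF assms(1), of x] assms(2) by simp
  show "max 0 (f x - e) = 0" if "x \<notin> W" for x
    using that assms(3) by (cases "e \<le> f x") auto
qed auto

lemma closed_superlevel: "f \<in> below V \<Longrightarrow> closed {x. e \<le> f x}"
  by (intro closed_Collect_le continuous_intros belowD(1))

text \<open>K - V and K - W are disjoint closed sets because K lies in the union. A Urysohn function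
  h for them splits g, which lives on K, into h g vanishing off V and (1 - h) g vanishing off
  W.\<close>

lemma content_Un:
  assumes "open V" "open W"
  shows "content (V \<union> W) \<le> content V + content W"
proof (rule content_leI)
  fix f e assume f: "f \<in> below (V \<union> W)" and e: "0 < (e::real)"
  define K where "K = {x. e \<le> f x}"
  have K: "closed K" "K \<subseteq> V \<union> W"
    using closed_superlevel[OF f] belowD(5)[OF f] e by (auto simp: K_def intro: order_less_le_trans)
  obtain h where h: "continuous_on UNIV h" "\<And>x. 0 \<le> h x" "\<And>x. h x \<le> 1"
    "\<And>x. x \<in> K - V \<Longrightarrow> h x = 0" "\<And>x. x \<in> K - W \<Longrightarrow> h x = (1::real)"
    using urysohn_compact[OF compact_UNIV, of "K - V" "K - W"] K assms by blast
  define g where "g = (\<lambda>x. max 0 (f x - e))"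
  have g: "g \<in> below K" unfolding g_def by (rule cut_below[OF f e]) (auto simp: K_def)
  note gD = belowD[OF g]
  have 1: "(\<lambda>x. h x * g x) \<in> below V"
  proof (rule belowI)
    show "h x * g x = 0" if "x \<notin> V" for x using that h(4)[of x] gD(4)[of x] by auto
  qed (use h gD(1-3) in \<open>auto intro!: continuous_intros mult_le_one\<close>)
  have 2: "(\<lambda>x. (1 - h x) * g x) \<in> below W"
  proof (rule belowI)
    show "(1 - h x) * g x = 0" if "x \<notin> W" for x using that h(5)[of x] gD(4)[of x] by auto
  qed (use h gD(1-3) in \<open>auto intro!: continuous_intros mult_le_one\<close>)
  have "L g = L (\<lambda>x. h x * g x + (1 - h x) * g x)" by (simp add: algebra_simps)
  also have "\<dots> = L (\<lambda>x. h x * g x) + L (\<lambda>x. (1 - h x) * g x)"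
    by (rule add) (use h gD(1) in \<open>auto intro!: continuous_intros\<close>)
  finally have "ennreal (L g) = ennreal (L (\<lambda>x. h x * g x)) + ennreal (L (\<lambda>x. (1 - h x) * g x))"
    by (simp add: ennreal_plus nonneg belowD[OF 1] belowD[OF 2])
  also have "\<dots> \<le> content V + content W"
    by (intro add_mono le_content 1 2)
  finally show "ennreal (L (\<lambda>x. max 0 (f x - e))) \<le> content V + content W" by (simp add: g_def)
qed

lemma content_UN_lessThan:
  assumes "\<And>i::nat. open (V i)"
  shows "content (\<Union>i<n. V i) \<le> (\<Sum>i<n. content (V i))"
proof (induction n)
  case (Suc n)
  have "content (\<Union>i<Suc n. V i) \<le> content (\<Union>i<n. V i) + content (V n)"
    using content_Un[of "\<Union>i<n. V i" "V n"] assms by (simp add: lessThan_Suc Un_commute open_UN)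
  with Suc show ?case by (simp add: add_right_mono order_trans)
qed (simp add: content_empty)

text \<open>Compactness of the set {e \<le> f} turns the countable cover into a finite one.\<close>

lemma content_UN:
  assumes "\<And>i::nat. open (V i)"
  shows "content (\<Union>i. V i) \<le> (\<Sum>i. content (V i))"
proof (rule content_leI)
  fix f e assume f: "f \<in> below (\<Union>i. V i)" and e: "0 < (e::real)"
  define K where "K = {x. e \<le> f x}"
  have "compact K"
    using closed_superlevel[OF f] compact_eq_closed_compact_space[OF compact_UNIV] by (simp add: K_def)
  moreover have "K \<subseteq> (\<Union>i. V i)"
    using belowD(5)[OF f] e by (auto simp: K_def intro: order_less_le_trans)
  ultimately obtain I where I: "finite I" "K \<subseteq> (\<Union>i\<in>I. V i)"
    using compactE_image[of K UNIV V] assms by metis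
  then obtain n where "I \<subseteq> {..<n}" using finite_nat_bounded by blast
  with I have Kn: "K \<subseteq> (\<Union>i<n. V i)" by blast
  have "ennreal (L (\<lambda>x. max 0 (f x - e))) \<le> content (\<Union>i<n. V i)"
    by (intro le_content cut_below[OF f e]) (use Kn in \<open>simp add: K_def\<close>)
  also have "\<dots> \<le> (\<Sum>i<n. content (V i))" by (rule content_UN_lessThan[OF assms])
  also have "\<dots> \<le> (\<Sum>i. content (V i))" by (rule sum_le_suminf) auto
  finally show "ennreal (L (\<lambda>x. max 0 (f x - e))) \<le> (\<Sum>i. content (V i))" .
qed

lemma outer_lessD: "outer E < c \<Longrightarrow> \<exists>V. open V \<and> E \<subseteq> V \<and> content V < c"
  unfolding outer_def INF_less_iff by blast

lemma outer_countably_subadditive: "outer (\<Union>i. E i) \<le> (\<Sum>i::nat. outer (E i))"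
proof (rule ennreal_le_epsilon)
  fix e :: real assume e: "0 < e"
  have "\<exists>V. open V \<and> E i \<subseteq> V \<and> content V \<le> outer (E i) + ennreal (e * (1/2) ^ Suc i)" for i
  proof -
    have "0 < ennreal (e * (1/2) ^ Suc i)"
      using e by simp
    then have "outer (E i) + 0 < outer (E i) + ennreal (e * (1/2) ^ Suc i)"
      using outer_less_top[of "E i"] ennreal_add_left_cancel_less less_irrefl by metis
    then obtain V where "open V" "E i \<subseteq> V" "content V < outer (E i) + ennreal (e * (1/2) ^ Suc i)"
      unfolding add_0_right using outer_lessD by blast
    then show ?thesis using less_imp_le by blast
  qed
  then obtain V where V: "\<And>i. open (V i)" "\<And>i. E i \<subseteq> V i"
      "\<And>i. content (V i) \<le> outer (E i) + ennreal (e * (1/2) ^ Suc i)"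
    by metis
  have "outer (\<Union>i. E i) \<le> content (\<Union>i. V i)"
    by (rule outer_le) (use V in auto)
  also have "\<dots> \<le> (\<Sum>i. content (V i))" by (rule content_UN[OF V(1)])
  also have "\<dots> \<le> (\<Sum>i. outer (E i) + ennreal (e * (1/2) ^ Suc i))"
    by (intro suminf_le V) auto
  also have "\<dots> = (\<Sum>i. outer (E i)) + (\<Sum>i. ennreal (e * (1/2) ^ Suc i))"
    by (intro suminf_add[symmetric]) auto
  also have "(\<Sum>i. ennreal (e * (1/2) ^ Suc i)) = ennreal e"
    using e sums_mult[OF power_half_series, of e] by (intro suminf_ennreal_eq) auto
  finally show "outer (\<Union>i. E i) \<le> (\<Sum>i. outer (E i)) + ennreal e" .
qed

lemma outer_empty: "outer {} = 0"
  using outer_open[of "{}"] content_empty by simp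

lemma outer_Un: "outer (E \<union> F) \<le> outer E + outer F"
proof -
  define G where "G = (\<lambda>i::nat. if i = 0 then E else if i = 1 then F else {})"
  have "E \<union> F = (\<Union>i. G i)" by (auto simp: G_def split: if_splits)
  moreover have "(\<Sum>i. outer (G i)) = (\<Sum>i<2. outer (G i))"
    by (rule suminf_finite) (auto simp: G_def outer_empty)
  ultimately show ?thesis
    using outer_countably_subadditive[of G] by (simp add: G_def numeral_2_eq_2)
qed

text \<open>g nearly exhausts W \<inter> V and lives on a closed K inside it. Any k below the open
  set W - K, which contains W - V, vanishes on K, so k + g is still below W and the two
  contributions add up.\<close>

lemma content_split:
  assumes "open V" "open W"
  shows "content (W \<inter> V) + outer (W - V) \<le> content W"
proof -
  have "content (W \<inter> V) \<le> content W - outer (W - V)"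
  proof (rule content_leI)
    fix f e assume f: "f \<in> below (W \<inter> V)" and e: "0 < (e::real)"
    define K where "K = {x. e \<le> f x}"
    have K: "closed K" "K \<subseteq> W \<inter> V"
      using closed_superlevel[OF f] belowD(5)[OF f] e by (auto simp: K_def intro: order_less_le_trans)
    define g where "g = (\<lambda>x. max 0 (f x - e))"
    have g: "g \<in> below K" unfolding g_def by (rule cut_below[OF f e]) (auto simp: K_def)
    have "ennreal (L g) + content (W - K) \<le> content W"
    proof -
      have "content (W - K) \<le> content W - ennreal (L g)"
        unfolding content_def[of "W - K"]
      proof (rule SUP_least)
        fix k assume k: "k \<in> below (W - K)"
        note gD = belowD[OF g] and kD = belowD[OF k]
        have "(\<lambda>x. k x + g x) \<in> below W"
        proof (rule belowI)
          show "k x + g x \<le> 1" for x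
            using gD(3,4)[of x] kD(3,4)[of x] by (cases "x \<in> K") auto
          show "k x + g x = 0" if "x \<notin> W" for x using that gD(4)[of x] kD(4)[of x] K by auto
        qed (use gD(1,2) kD(1,2) in \<open>auto intro!: continuous_intros\<close>)
        from le_content[OF this] have "ennreal (L k) + ennreal (L g) \<le> content W"
          using gD(1,2) kD(1,2) by (simp add: add nonneg ennreal_plus)
        then show "ennreal (L k) \<le> content W - ennreal (L g)"
          by (simp add: ennreal_le_minus_iff)
      qed
      moreover have "ennreal (L g) \<le> content W"
        by (intro le_content) (use cut_below[OF f e, of W] K in \<open>auto simp: g_def K_def\<close>)
      ultimately show ?thesis
        by (metis add.commute add_right_mono diff_add_cancel_ennreal)
    qed
    moreover have "outer (W - V) \<le> content (W - K)"
      by (rule outer_le) (use assms K in auto)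
    ultimately have "ennreal (L g) + outer (W - V) \<le> content W"
      by (meson add_left_mono order_trans)
    then show "ennreal (L (\<lambda>x. max 0 (f x - e))) \<le> content W - outer (W - V)"
      by (simp add: g_def ennreal_le_minus_iff)
  qed
  moreover have "outer (W - V) \<le> content W" by (rule outer_le) (use assms in auto)
  ultimately show ?thesis by (metis add_right_mono diff_add_cancel_ennreal)
qed

lemma open_caratheodory:
  assumes "open V"
  shows "outer (V \<inter> E) + outer (E - V) \<le> outer E"
  unfolding outer_def[of E]
proof (rule INF_greatest)
  fix W assume "W \<in> {V. open V \<and> E \<subseteq> V}"
  then have W: "open W" "E \<subseteq> W" by auto
  have "outer (V \<inter> E) + outer (E - V) \<le> content (W \<inter> V) + outer (W - V)"
    by (intro add_mono outer_le outer_mono) (use W assms in auto)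
  also have "\<dots> \<le> content W" by (rule content_split[OF assms W(1)])
  finally show "outer (V \<inter> E) + outer (E - V) \<le> content W" .
qed

definition riesz_measure :: "'a measure" where
  "riesz_measure = measure_of UNIV (sets borel) outer"

lemma sets_riesz_measure [simp, measurable_cong]: "sets riesz_measure = sets borel"
  unfolding riesz_measure_def by (simp add: sets.sigma_sets_eq[of borel, simplified])

lemma space_riesz_measure [simp]: "space riesz_measure = UNIV"
  unfolding riesz_measure_def by (simp add: space_measure_of_conv)

text \<open>Caratheodory: \<open>outer\<close> is a measure on its lambda system, which contains the
  open sets by \<open>open_caratheodory\<close> and hence all Borel sets. This validates the use of
  \<open>measure_of\<close>, which would otherwise return the zero measure.\<close>

lemma emeasure_riesz_measure:
  assumes "B \<in> sets borel"
  shows "emeasure riesz_measure B = outer B"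
proof -
  have oms: "outer_measure_space UNIV outer"
    using outer_countably_subadditive outer_mono
    by (auto simp: outer_measure_space_def positive_def increasing_def countably_subadditive_def outer_empty)
  interpret P: sigma_algebra UNIV "UNIV :: 'a set set" by (metis Pow_UNIV sigma_algebra_Pow)
  define M where "M = lambda_system UNIV UNIV outer"
  have M: "measure_space UNIV M outer"
    unfolding M_def by (rule P.caratheodory_lemma[OF oms])
  then interpret M: sigma_algebra UNIV M by (simp add: measure_space_def)
  have "V \<in> M" if V: "open V" for V
  proof -
    have "outer (V \<inter> E) + outer (E - V) = outer E" for E
      using open_caratheodory[OF V, of E] outer_Un[of "V \<inter> E" "E - V"]
      by (metis Int_Diff_Un Int_commute antisym)
    then show ?thesis
      by (simp add: M_def lambda_system_def Diff_eq Int_commute)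
  qed
  then have "sets borel \<subseteq> M"
    unfolding borel_def by (subst sets_measure_of) (auto intro!: M.sigma_sets_subset)
  with M have "measure_space UNIV (sets borel) outer"
    using sets.sigma_algebra_axioms[of "borel :: 'a measure"]
    by (auto simp: measure_space_def positive_def countably_additive_def)
  then show ?thesis
    unfolding riesz_measure_def
    by (intro emeasure_measure_of_sigma)
       (use assms in \<open>auto simp: measure_space_def\<close>)
qed

end

section \<open>Regular measures\<close>

lemma regular_borel_measureI:
  assumes "sets M = sets borel" "finite_measure M"
    and K: "\<And>B e. B \<in> sets borel \<Longrightarrow> 0 < e \<Longrightarrow> \<exists>K. compact K \<and> K \<subseteq> B \<and> measure M B \<le> measure M K + e"
    and U: "\<And>B e. B \<in> sets borel \<Longrightarrow> 0 < e \<Longrightarrow> \<exists>U. open U \<and> B \<subseteq> U \<and> measure M U \<le> measure M B + e"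
  shows "regular_borel_measure (M :: 'a::t2_space measure)"
proof -
  interpret finite_measure M by fact
  have sets: "B \<in> sets borel \<Longrightarrow> B \<in> sets M" for B using assms(1) by simp
  have "emeasure M B = (SUP K\<in>{K. compact K \<and> K \<subseteq> B}. emeasure M K)" if B: "B \<in> sets borel" for B
  proof (rule antisym)
    show "emeasure M B \<le> (SUP K\<in>{K. compact K \<and> K \<subseteq> B}. emeasure M K)"
    proof (rule ennreal_le_epsilon)
      fix e :: real assume e: "0 < e"
      obtain K where K: "compact K" "K \<subseteq> B" "measure M B \<le> measure M K + e" using K[OF B e] by auto
      then have "emeasure M B \<le> emeasure M K + ennreal e"
        using e by (simp add: emeasure_eq_measure flip: ennreal_plus)
      also have "\<dots> \<le> (SUP K\<in>{K. compact K \<and> K \<subseteq> B}. emeasure M K) + ennreal e"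
        using K by (intro add_right_mono SUP_upper) auto
      finally show "emeasure M B \<le> \<dots>" .
    qed
    show "(SUP K\<in>{K. compact K \<and> K \<subseteq> B}. emeasure M K) \<le> emeasure M B"
      by (intro SUP_least emeasure_mono) (use B sets in auto)
  qed
  moreover have "emeasure M B = (INF U\<in>{U. open U \<and> B \<subseteq> U}. emeasure M U)" if B: "B \<in> sets borel" for B
  proof (rule antisym)
    show "(INF U\<in>{U. open U \<and> B \<subseteq> U}. emeasure M U) \<le> emeasure M B"
    proof (rule ennreal_le_epsilon)
      fix e :: real assume e: "0 < e"
      obtain U where U: "open U" "B \<subseteq> U" "measure M U \<le> measure M B + e" using U[OF B e] by auto
      then have "(INF U\<in>{U. open U \<and> B \<subseteq> U}. emeasure M U) \<le> emeasure M U"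
        by (intro INF_lower) auto
      also have "\<dots> \<le> emeasure M B + ennreal e"
        using U e by (simp add: emeasure_eq_measure flip: ennreal_plus)
      finally show "(INF U\<in>{U. open U \<and> B \<subseteq> U}. emeasure M U) \<le> \<dots>" .
    qed
    show "emeasure M B \<le> (INF U\<in>{U. open U \<and> B \<subseteq> U}. emeasure M U)"
      by (intro INF_greatest emeasure_mono) (use sets in auto)
  qed
  ultimately show ?thesis
    unfolding regular_borel_measure_def using assms(1,2) by blast
qed

lemma regular_borel_measureD:
  assumes "regular_borel_measure M"
  shows "sets M = sets borel" "finite_measure M" "space M = UNIV"
  using assms sets_eq_imp_space_eq[of M borel] by (auto simp: regular_borel_measure_def)

lemma regular_borel_measure_SUP:
  "regular_borel_measure M \<Longrightarrow> B \<in> sets borel \<Longrightarrow>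
    emeasure M B = (SUP K\<in>{K. compact K \<and> K \<subseteq> B}. emeasure M K)"
  unfolding regular_borel_measure_def by blast

lemma regular_borel_measure_INF:
  "regular_borel_measure M \<Longrightarrow> B \<in> sets borel \<Longrightarrow>
    emeasure M B = (INF U\<in>{U. open U \<and> B \<subseteq> U}. emeasure M U)"
  unfolding regular_borel_measure_def by blast

lemma regular_borel_measure_innerD:
  assumes "regular_borel_measure M" "B \<in> sets borel" "0 < e"
  obtains K where "compact K" "K \<subseteq> B" "measure M B \<le> measure M K + e"
proof -
  interpret finite_measure M using regular_borel_measureD[OF assms(1)] by simp
  have "\<exists>K. compact K \<and> K \<subseteq> B \<and> measure M B \<le> measure M K + e"
  proof (rule ccontr)
    assume neg: "\<not> ?thesis"
    have less: "measure M K < measure M B - e" if K: "compact K" "K \<subseteq> B" for K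
    proof (rule ccontr)
      assume "\<not> measure M K < measure M B - e"
      then have "measure M B \<le> measure M K + e" by linarith
      with neg K show False by blast
    qed
    have "emeasure M B = (SUP K\<in>{K. compact K \<and> K \<subseteq> B}. emeasure M K)"
      by (rule regular_borel_measure_SUP[OF assms(1,2)])
    also have "\<dots> \<le> ennreal (measure M B - e)"
    proof (rule SUP_least)
      fix K assume "K \<in> {K. compact K \<and> K \<subseteq> B}"
      then have "measure M K \<le> measure M B - e" using less[of K] by simp
      then show "emeasure M K \<le> ennreal (measure M B - e)"
        unfolding emeasure_eq_measure by (rule ennreal_leI)
    qed
    finally have "ennreal (measure M B) \<le> ennreal (measure M B - e)" unfolding emeasure_eq_measure .
    \<comment> \<open>\<open>ennreal\<close> truncates at 0, so the right side must be known to be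
      nonnegative; the empty compact set shows this.\<close>
    then have "measure M B \<le> measure M B - e"
      using less[of "{}"] by (subst (asm) ennreal_le_iff) auto
    with assms(3) show False by simp
  qed
  then show thesis using that by auto
qed

lemma regular_borel_measure_outerD:
  assumes "regular_borel_measure M" "B \<in> sets borel" "0 < e"
  obtains U where "open U" "B \<subseteq> U" "measure M U \<le> measure M B + e"
proof -
  interpret finite_measure M using regular_borel_measureD[OF assms(1)] by simp
  have "(INF U\<in>{U. open U \<and> B \<subseteq> U}. emeasure M U) < ennreal (measure M B + e)"
    unfolding regular_borel_measure_INF[OF assms(1,2), symmetric]
    using assms(3) by (simp add: emeasure_eq_measure ennreal_less_iff)
  then obtain U where "open U" "B \<subseteq> U" "emeasure M U < ennreal (measure M B + e)"
    by (auto simp: INF_less_iff)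
  then show thesis using that[of U] by (simp add: emeasure_eq_measure ennreal_less_iff)
qed

text \<open>In a compact space, inner and outer regularity are exchanged by complementation.\<close>

lemma regular_borel_measureI_outer:
  assumes cpt: "compact (UNIV :: 'a::t2_space set)" and M: "sets M = sets borel" "finite_measure M"
    and U: "\<And>B e. B \<in> sets borel \<Longrightarrow> 0 < e \<Longrightarrow> \<exists>U. open U \<and> B \<subseteq> U \<and> measure M U \<le> measure M B + e"
  shows "regular_borel_measure (M :: 'a measure)"
proof (rule regular_borel_measureI[OF M])
  interpret finite_measure M by fact
  have sp: "space M = UNIV" using sets_eq_imp_space_eq[OF M(1)] by simp
  fix B :: "'a set" and e :: real assume B: "B \<in> sets borel" and e: "0 < e"
  obtain U where U: "open U" "- B \<subseteq> U" "measure M U \<le> measure M (- B) + e"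
    using U[of "- B" e] B e by (auto simp: borel_comp)
  have "measure M B = measure M UNIV - measure M (- B)" "measure M (- U) = measure M UNIV - measure M U"
    using finite_measure_compl[of "- B"] finite_measure_compl[of U] B U(1) M sp
    by (auto simp: Compl_eq_Diff_UNIV borel_comp Diff_Diff_Int)
  with U show "\<exists>K. compact K \<and> K \<subseteq> B \<and> measure M B \<le> measure M K + e"
    by (intro exI[of _ "- U"]) (auto simp: compact_eq_closed_compact_space[OF cpt])
qed (use U in auto)

lemma regular_borel_measureI_inner:
  assumes cpt: "compact (UNIV :: 'a::t2_space set)" and M: "sets M = sets borel" "finite_measure M"
    and K: "\<And>B e. B \<in> sets borel \<Longrightarrow> 0 < e \<Longrightarrow> \<exists>K. compact K \<and> K \<subseteq> B \<and> measure M B \<le> measure M K + e"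
  shows "regular_borel_measure (M :: 'a measure)"
proof (rule regular_borel_measureI[OF M])
  interpret finite_measure M by fact
  have sp: "space M = UNIV" using sets_eq_imp_space_eq[OF M(1)] by simp
  fix B :: "'a set" and e :: real assume B: "B \<in> sets borel" and e: "0 < e"
  obtain K where K: "compact K" "K \<subseteq> - B" "measure M (- B) \<le> measure M K + e"
    using K[of "- B" e] B e by (auto simp: borel_comp)
  note cl = compact_imp_closed[OF K(1)]
  have "measure M B = measure M UNIV - measure M (- B)" "measure M (- K) = measure M UNIV - measure M K"
    using finite_measure_compl[of "- B"] finite_measure_compl[of K] B cl M sp
    by (auto simp: Compl_eq_Diff_UNIV borel_comp Diff_Diff_Int)
  with K cl show "\<exists>U. open U \<and> B \<subseteq> U \<and> measure M U \<le> measure M B + e"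
    by (intro exI[of _ "- K"]) auto
qed (use K in auto)

text \<open>Continuous images of compact sets are compact, so an inner approximation K of the
  preimage of B transfers to its image under \<alpha>; compactness of the space then gives the outer
  half.\<close>

lemma regular_borel_measure_distr:
  assumes cpt: "compact (UNIV :: 'a::t2_space set)" and M: "regular_borel_measure (M :: 'a measure)"
    and "continuous_on UNIV \<alpha>"
  shows "regular_borel_measure (distr M borel (\<alpha> :: 'a \<Rightarrow> 'a))"
proof (rule regular_borel_measureI_inner[OF cpt])
  note MD = regular_borel_measureD[OF M]
  interpret finite_measure M by (rule MD)
  have meas [measurable]: "\<alpha> \<in> measurable M borel"
    using borel_measurable_continuous_onI[OF assms(3)] MD(1) measurable_cong_sets by blast
  show "finite_measure (distr M borel \<alpha>)" by (rule finite_measure_distr[OF meas])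
  fix B :: "'a set" and e :: real assume B: "B \<in> sets borel" and e: "0 < e"
  have "\<alpha> -` B \<in> sets borel"
    using measurable_sets[OF meas B] MD by simp
  then obtain K where K: "compact K" "K \<subseteq> \<alpha> -` B" "measure M (\<alpha> -` B) \<le> measure M K + e"
    using regular_borel_measure_innerD[OF M _ e] by metis
  have c: "compact (\<alpha> ` K)"
    using compact_continuous_image[OF continuous_on_subset[OF assms(3)] K(1)] by simp
  then have b: "\<alpha> ` K \<in> sets borel" by (simp add: compact_imp_closed)
  have "measure M K \<le> measure M (\<alpha> -` (\<alpha> ` K))"
    using measurable_sets[OF meas b] MD by (intro finite_measure_mono) auto
  with K c b B show "\<exists>K. compact K \<and> K \<subseteq> B \<and> measure (distr M borel \<alpha>) B \<le> measure (distr M borel \<alpha>) K + e"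
    by (intro exI[of _ "\<alpha> ` K"]) (auto simp: measure_distr[OF meas] MD)
qed simp

lemma bounded_continuous_compact:
  fixes f :: "'a::t2_space \<Rightarrow> real"
  assumes "compact (UNIV :: 'a set)" "continuous_on UNIV f"
  obtains c where "0 < c" "\<And>x. \<bar>f x\<bar> \<le> c"
proof -
  have "bounded (range f)"
    using compact_continuous_image[OF assms(2,1)] by (rule compact_imp_bounded)
  then show thesis using that by (auto simp: bounded_pos)
qed

lemma integrable_continuous_compact:
  fixes f :: "'a::t2_space \<Rightarrow> real"
  assumes "compact (UNIV :: 'a set)" "regular_borel_measure M" "continuous_on UNIV f"
  shows "integrable M f"
proof -
  note MD = regular_borel_measureD[OF assms(2)]
  interpret finite_measure M by (rule MD)
  obtain c where "\<And>x. \<bar>f x\<bar> \<le> c" using bounded_continuous_compact[OF assms(1,3)] by metis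
  moreover have "f \<in> borel_measurable M"
    using borel_measurable_continuous_onI[OF assms(3)] MD(1) measurable_cong_sets by blast
  ultimately show ?thesis by (intro integrable_const_bound[of _ c]) auto
qed

lemma measure_le_integral:
  fixes f :: "'a::t2_space \<Rightarrow> real"
  assumes cpt: "compact (UNIV :: 'a set)" and M: "regular_borel_measure M" and f: "continuous_on UNIV f"
    and "\<And>x. 0 \<le> f x" "\<And>x. x \<in> B \<Longrightarrow> 1 \<le> f x" "B \<in> sets borel"
  shows "measure M B \<le> integral\<^sup>L M f"
proof -
  note MD = regular_borel_measureD[OF M]
  interpret finite_measure M by (rule MD)
  have "measure M B = integral\<^sup>L M (indicator B)" using MD by simp
  also have "\<dots> \<le> integral\<^sup>L M f"
    using assms MD by (intro integral_mono integrable_continuous_compact[OF cpt M f])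
      (auto simp: indicator_def integrable_indicator_iff emeasure_eq_measure)
  finally show ?thesis .
qed

lemma integral_le_measure:
  fixes f :: "'a::t2_space \<Rightarrow> real"
  assumes cpt: "compact (UNIV :: 'a set)" and M: "regular_borel_measure M" and f: "continuous_on UNIV f"
    and "\<And>x. f x \<le> 1" "\<And>x. x \<notin> B \<Longrightarrow> f x \<le> 0" "B \<in> sets borel"
  shows "integral\<^sup>L M f \<le> measure M B"
proof -
  note MD = regular_borel_measureD[OF M]
  interpret finite_measure M by (rule MD)
  have "integral\<^sup>L M f \<le> integral\<^sup>L M (indicator B)"
    using assms MD by (intro integral_mono integrable_continuous_compact[OF cpt M f])
      (auto simp: indicator_def integrable_indicator_iff emeasure_eq_measure)
  also have "\<dots> = measure M B" using MD by simp
  finally show ?thesis .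
qed

text \<open>Urysohn functions between a compact K and an open U around it compare M and N on open
  sets, by inner regularity; outer regularity extends the equality to Borel sets.\<close>

lemma regular_borel_measure_eqI:
  assumes cpt: "compact (UNIV :: 'a::t2_space set)"
    and M: "regular_borel_measure (M :: 'a measure)" and N: "regular_borel_measure N"
    and eq: "\<And>f. continuous_on UNIV f \<Longrightarrow> integral\<^sup>L M f = integral\<^sup>L N (f :: 'a \<Rightarrow> real)"
  shows "M = N"
proof -
  have le: "measure M U \<le> measure N U"
    if MN: "regular_borel_measure M" "regular_borel_measure N"
      and eq: "\<And>f. continuous_on UNIV f \<Longrightarrow> integral\<^sup>L M f = integral\<^sup>L N (f :: 'a \<Rightarrow> real)"
      and U: "open U" for U and M N :: "'a measure"
  proof (rule field_le_epsilon)
    fix e :: real assume e: "0 < e"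
    obtain K where K: "compact K" "K \<subseteq> U" "measure M U \<le> measure M K + e"
      using regular_borel_measure_innerD[OF MN(1) _ e, of U] U by auto
    obtain h where h: "continuous_on UNIV h" "\<And>x. 0 \<le> h x" "\<And>x. h x \<le> 1"
      "\<And>x. x \<in> - U \<Longrightarrow> h x = 0" "\<And>x. x \<in> K \<Longrightarrow> h x = (1::real)"
      using urysohn_compact[OF cpt, of "- U" K] K U by (metis Compl_disjoint2 Int_commute closed_Compl
        compact_imp_closed disjoint_eq_subset_Compl double_complement)
    have "measure M K \<le> integral\<^sup>L M h"
      using h K(1) by (intro measure_le_integral[OF cpt MN(1)]) (auto simp: compact_imp_closed)
    also have "\<dots> = integral\<^sup>L N h" by (rule eq[OF h(1)])
    also have "\<dots> \<le> measure N U"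
      using h U by (intro integral_le_measure[OF cpt MN(2)]) auto
    finally show "measure M U \<le> measure N U + e" using K(3) by simp
  qed
  have open_eq: "emeasure M U = emeasure N U" if "open U" for U
    using le[OF M N eq that] le[OF N M eq[symmetric] that]
      finite_measure.emeasure_eq_measure[OF regular_borel_measureD(2)[OF M]]
      finite_measure.emeasure_eq_measure[OF regular_borel_measureD(2)[OF N]] by simp
  show ?thesis
  proof (rule measure_eqI)
    show "sets M = sets N" using regular_borel_measureD(1)[OF M] regular_borel_measureD(1)[OF N] by simp
    fix B assume "B \<in> sets M"
    then have B: "B \<in> sets borel" using regular_borel_measureD(1)[OF M] by simp
    have "emeasure M B = (INF U\<in>{U. open U \<and> B \<subseteq> U}. emeasure M U)"
      by (rule regular_borel_measure_INF[OF M B])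
    also have "\<dots> = (INF U\<in>{U. open U \<and> B \<subseteq> U}. emeasure N U)"
      by (rule INF_cong) (auto simp: open_eq)
    also have "\<dots> = emeasure N B"
      by (rule regular_borel_measure_INF[OF N B, symmetric])
    finally show "emeasure M B = emeasure N B" .
  qed
qed

section \<open>The representation formula for the constructed measure\<close>

context positive_functional
begin

lemma regular_riesz_measure: "regular_borel_measure riesz_measure"
proof (rule regular_borel_measureI_outer[OF compact_UNIV])
  show fin: "finite_measure riesz_measure"
    using outer_less_top[of UNIV] by (intro finite_measureI) (simp add: emeasure_riesz_measure)
  interpret finite_measure riesz_measure by fact
  fix B :: "'a set" and e :: real assume B: "B \<in> sets borel" and e: "0 < e"
  have "outer B + 0 < outer B + ennreal e"
    using outer_less_top[of B] e ennreal_add_left_cancel_less less_irrefl ennreal_less_zero_iff by (metis ennreal_eq_0_iff not_less zero_less_iff_neq_zero)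
  then obtain V where V: "open V" "B \<subseteq> V" "content V < outer B + ennreal e"
    unfolding add_0_right using outer_lessD by blast
  then have "emeasure riesz_measure V < emeasure riesz_measure B + ennreal e"
    using B by (simp add: emeasure_riesz_measure outer_open)
  then have "measure riesz_measure V < measure riesz_measure B + e"
    using e by (simp add: emeasure_eq_measure ennreal_less_iff flip: ennreal_plus)
  with V show "\<exists>U. open U \<and> B \<subseteq> U \<and> measure riesz_measure U \<le> measure riesz_measure B + e"
    by (auto intro: less_imp_le)
qed simp

lemma le_measure_open:
  assumes "open V" "f \<in> below V"
  shows "L f \<le> measure riesz_measure V"
proof -
  interpret finite_measure riesz_measure using regular_borel_measureD[OF regular_riesz_measure] by simp
  have "ennreal (L f) \<le> ennreal (measure riesz_measure V)"
    using le_content[OF assms(2)] assms(1)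
    by (simp add: emeasure_riesz_measure outer_open flip: emeasure_eq_measure)
  then show ?thesis by simp
qed

lemma measure_riesz_UNIV: "measure riesz_measure UNIV = L (\<lambda>x. 1)"
proof (rule antisym)
  interpret finite_measure riesz_measure using regular_borel_measureD[OF regular_riesz_measure] by simp
  have "emeasure riesz_measure UNIV \<le> ennreal (L (\<lambda>x. 1))"
    using content_le_total by (simp add: emeasure_riesz_measure outer_open)
  then show "measure riesz_measure UNIV \<le> L (\<lambda>x. 1)"
    using nonneg[of "\<lambda>x. 1"] by (simp add: emeasure_eq_measure)
  show "L (\<lambda>x. 1) \<le> measure riesz_measure UNIV"
    by (rule le_measure_open) (auto intro: belowI)
qed

text \<open>Layer-cake decomposition: n f is the sum over k < n of its clamped layers, and layer k
  lies below the indicator of {k < n f}, whose measure bounds the value of L on it. At most n f + 1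
  of these indicators are 1 at a point, so dividing by n leaves an error of total mass / n. One
  inequality suffices because it also applies to 1 - f.\<close>

lemma riesz_le_integral:
  assumes f: "continuous_on UNIV f" "\<And>x. 0 \<le> f x" "\<And>x. f x \<le> 1"
  shows "L f \<le> integral\<^sup>L riesz_measure f"
proof (rule field_le_epsilon)
  interpret finite_measure riesz_measure using regular_borel_measureD[OF regular_riesz_measure] by simp
  define c where "c = measure riesz_measure UNIV"
  fix e :: real assume e: "0 < e"
  obtain n0 :: nat where "c / e < real n0" using reals_Archimedean2 by blast
  then obtain n :: nat where n: "c / e < real n" "0 < n" using that[of "Suc n0"] by simp
  define g where "g = (\<lambda>k x. min 1 (max 0 (real n * f x - real k)))"
  define V where "V = (\<lambda>k. {x. real k < real n * f x})"
  have V: "open (V k)" for k unfolding V_def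
    by (intro open_Collect_less continuous_intros f)
  have g: "g k \<in> below (V k)" for k
    by (rule belowI) (auto simp: g_def V_def intro!: continuous_intros f)
  have sum_clamp: "(\<Sum>k<m. min 1 (max 0 (t - real k))) = min (real m) (max 0 t)" for m and t :: real
    by (induction m) (auto simp: min_def max_def)
  have sum_ind: "(\<Sum>k<m. if real k < t then 1 else 0) \<le> t + (1::real)" if "0 \<le> t" for m t
  proof (induction m)
    case (Suc m)
    have "(\<Sum>k<m. if real k < t then 1 else 0) \<le> (\<Sum>k<m. 1 :: real)" by (rule sum_mono) auto
    with Suc show ?case by auto
  qed (use that in simp)
  have "real n * L f = L (\<lambda>x. \<Sum>k<n. g k x)"
  proof -
    have "(\<Sum>k<n. g k x) = real n * f x" for x
      unfolding g_def sum_clamp using f(2,3)[of x] n by (simp add: min_def max_def mult_le_cancel_left1)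
    then show ?thesis by (simp add: scale f)
  qed
  also have "\<dots> = (\<Sum>k<n. L (g k))"
    using g by (intro sum) (auto dest: belowD(1))
  also have "\<dots> \<le> (\<Sum>k<n. measure riesz_measure (V k))"
    by (intro sum_mono le_measure_open V g)
  also have "\<dots> = (\<integral>x. (\<Sum>k<n. indicator (V k) x) \<partial>riesz_measure)"
    using V by (subst Bochner_Integration.integral_sum) (auto simp: integrable_indicator_iff emeasure_eq_measure)
  also have "\<dots> \<le> (\<integral>x. real n * f x + 1 \<partial>riesz_measure)"
  proof (rule integral_mono)
    show "integrable riesz_measure (\<lambda>x. \<Sum>k<n. indicator (V k) x :: real)"
      using V by (intro Bochner_Integration.integrable_sum) (auto simp: integrable_indicator_iff emeasure_eq_measure)
    show "integrable riesz_measure (\<lambda>x. real n * f x + 1)"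
      by (intro integrable_continuous_compact[OF compact_UNIV regular_riesz_measure] continuous_intros f)
    show "(\<Sum>k<n. indicator (V k) x) \<le> real n * f x + 1" for x
      using sum_ind[of "real n * f x" n] f(2)[of x] by (simp add: V_def indicator_def of_bool_def)
  qed
  also have "\<dots> = real n * integral\<^sup>L riesz_measure f + c"
    using integrable_continuous_compact[OF compact_UNIV regular_riesz_measure f(1)]
    by (simp add: c_def)
  finally have "real n * L f \<le> real n * integral\<^sup>L riesz_measure f + c" .
  also have "\<dots> \<le> real n * (integral\<^sup>L riesz_measure f + e)"
    using n e by (simp add: field_simps)
  finally show "L f \<le> integral\<^sup>L riesz_measure f + e" using n by simp
qed

text \<open>\<open>riesz_le_integral\<close> for g and for 1 - g, together with equal total masses,
  gives equality for values in [0, 1]; a general f is rescaled affinely into that range.\<close>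

theorem riesz_representation:
  assumes f: "continuous_on UNIV f"
  shows "integral\<^sup>L riesz_measure f = L f"
proof -
  interpret finite_measure riesz_measure using regular_borel_measureD[OF regular_riesz_measure] by simp
  note int = integrable_continuous_compact[OF compact_UNIV regular_riesz_measure]
  have unit: "integral\<^sup>L riesz_measure g = L g"
    if g: "continuous_on UNIV g" "\<And>x. 0 \<le> g x" "\<And>x. g x \<le> 1" for g
    using riesz_le_integral[OF g] riesz_le_integral[of "\<lambda>x. 1 - g x"] diff[of "\<lambda>x. 1" g] g int[OF g(1)]
      measure_riesz_UNIV by (simp add: continuous_intros)
  obtain c where c: "0 < c" "\<And>x. \<bar>f x\<bar> \<le> c"
    using bounded_continuous_compact[OF compact_UNIV f] by metis
  define g where "g = (\<lambda>x. (1 / (2 * c)) * f x + 1 / 2)"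
  have g: "continuous_on UNIV g" unfolding g_def by (intro continuous_intros f)
  have "0 \<le> g x \<and> g x \<le> 1" for x
    using c(1) c(2)[of x] by (auto simp: g_def field_simps abs_le_iff)
  then have "integral\<^sup>L riesz_measure g = L g" using unit[OF g] by auto
  moreover have "integral\<^sup>L riesz_measure g = 1 / (2 * c) * integral\<^sup>L riesz_measure f + L (\<lambda>x. 1) / 2"
    unfolding g_def using int[OF f] measure_riesz_UNIV by simp
  moreover have "L g = 1 / (2 * c) * L f + L (\<lambda>x. 1) / 2"
  proof -
    have "continuous_on UNIV (\<lambda>x. 1 / (2 * c) * f x)" by (intro continuous_intros f)
    from add[OF this continuous_on_const, of "1/2"] show ?thesis
      unfolding g_def scale[OF f] const[of "1/2"] by simp
  qed
  ultimately show ?thesis using c(1) by simp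
qed

end

section \<open>Invariant measures and essential points\<close>

lemma measurable_continuous_regular:
  fixes f :: "'a::t2_space \<Rightarrow> 'b::topological_space"
  assumes "regular_borel_measure M" "continuous_on UNIV f"
  shows "f \<in> measurable M borel"
  using borel_measurable_continuous_onI[OF assms(2)] regular_borel_measureD(1)[OF assms(1)]
    measurable_cong_sets by blast

lemma funpow_continuous:
  assumes "continuous_on UNIV (\<alpha> :: 'a::topological_space \<Rightarrow> 'a)"
  shows "continuous_on UNIV (\<alpha> ^^ n)"
proof (induction n)
  case 0
  then show ?case by (simp add: id_def)
next
  case (Suc n)
  then show ?case using continuous_on_compose2[OF assms Suc] by (simp add: comp_def)
qed

text \<open>The cluster point is taken in the product of the intervals [-C f, C f], compact by
  Tychonoff. Linearity, positivity and normalisation are closed conditions on finitely many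
  coordinates and hold for all averages, so they pass to the limit.\<close>

lemma invariant_functional_exists:
  fixes \<alpha> :: "'a::t2_space \<Rightarrow> 'a"
  assumes cpt: "compact (UNIV :: 'a set)" and \<alpha>: "continuous_on UNIV \<alpha>"
  obtains L :: "('a \<Rightarrow> real) \<Rightarrow> real" where "positive_functional L" "L (\<lambda>x. 1) = 1"
    "\<And>f. continuous_on UNIV f \<Longrightarrow> L (\<lambda>x. f (\<alpha> x)) = L f"
proof -
  \<comment> \<open>\<open>undefined\<close> is just some starting point. The value 0 at
    discontinuous f, which may be unbounded, keeps every average inside the product of
    intervals.\<close>
  define avg :: "nat \<Rightarrow> ('a \<Rightarrow> real) \<Rightarrow> real" where
    "avg = (\<lambda>n f. if continuous_on UNIV f then (\<Sum>k\<le>n. f ((\<alpha> ^^ k) undefined)) / real (Suc n) else 0)"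
  have "\<forall>f. \<exists>c>0. continuous_on UNIV f \<longrightarrow> (\<forall>x::'a. \<bar>f x :: real\<bar> \<le> c)"
    using bounded_continuous_compact[OF cpt] zero_less_one by metis
  then obtain C :: "('a \<Rightarrow> real) \<Rightarrow> real"
    where C: "\<And>f. 0 < C f" "\<And>f x. continuous_on UNIV f \<Longrightarrow> \<bar>f x\<bar> \<le> C f" by metis
  define S where "S = PiE UNIV (\<lambda>f. {- C f .. C f})"
  have "compact S"
    using compactin_PiE[of "\<lambda>_. euclidean" UNIV "\<lambda>f. {- C f .. C f}"]
    by (simp add: S_def euclidean_product_topology)
  have avg_S: "avg n \<in> S" for n
  proof -
    have "\<bar>avg n f\<bar> \<le> C f" for f
    proof (cases "continuous_on UNIV f")
      case True
      have "\<bar>\<Sum>k\<le>n. f ((\<alpha> ^^ k) undefined)\<bar> \<le> (\<Sum>k\<le>n. C f)"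
        by (rule order_trans[OF sum_abs]) (intro sum_mono C(2) True)
      then show ?thesis using True by (simp add: avg_def field_simps)
    qed (use C(1)[of f] in \<open>simp add: avg_def\<close>)
    then show ?thesis by (auto simp: S_def PiE_def abs_le_iff minus_le_iff)
  qed
  define F where "F = filtermap avg sequentially"
  have "F \<noteq> bot" "F \<le> principal S"
    using avg_S by (auto simp: F_def filtermap_bot_iff le_principal eventually_filtermap)
  with \<open>compact S\<close> obtain L where L: "inf (nhds L) F \<noteq> bot"
    unfolding compact_filter le_principal by blast
  have closed_limit: "L \<in> Q" if "closed Q" "eventually (\<lambda>n. avg n \<in> Q) sequentially" for Q
  proof (rule ccontr)
    assume "L \<notin> Q"
    then have "eventually (\<lambda>y. y \<in> - Q) (nhds L)"
      using that(1) by (intro eventually_nhds_in_open) auto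
    moreover have "eventually (\<lambda>y. y \<in> Q) F"
      using that(2) by (simp add: F_def eventually_filtermap)
    ultimately have "eventually (\<lambda>_. False) (inf (nhds L) F)"
      unfolding eventually_inf by fastforce
    with L show False by simp
  qed
  have coord: "continuous_on UNIV (\<lambda>L :: ('a \<Rightarrow> real) \<Rightarrow> real. L f)" for f
    by (rule continuous_on_product_coordinates)
  show thesis
  proof (rule that[of L])
    show "positive_functional L"
    proof
      show "compact (UNIV :: 'a set)" by (rule cpt)
      fix f g :: "'a \<Rightarrow> real" and c :: real
      assume f: "continuous_on UNIV f"
      show "L (\<lambda>x. c * f x) = c * L f"
        using f by (intro closed_limit[of "{L. L (\<lambda>x. c * f x) = c * L f}", simplified])
          (auto intro!: closed_Collect_eq continuous_intros coord simp: avg_def sum_distrib_left)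
      show "L (\<lambda>x. f x + g x) = L f + L g" if g: "continuous_on UNIV g"
        using f g by (intro closed_limit[of "{L. L (\<lambda>x. f x + g x) = L f + L g}", simplified])
          (auto intro!: closed_Collect_eq continuous_intros coord simp: avg_def sum.distrib add_divide_distrib)
      show "0 \<le> L f" if "\<And>x. 0 \<le> f x"
        using f that by (intro closed_limit[of "{L. 0 \<le> L f}", simplified])
          (auto intro!: closed_Collect_le continuous_intros coord always_eventually divide_nonneg_nonneg sum_nonneg simp: avg_def)
    qed
    show "L (\<lambda>x. 1) = 1"
      by (intro closed_limit[of "{L. L (\<lambda>x. 1) = 1}", simplified])
        (auto intro!: closed_Collect_eq continuous_intros coord simp: avg_def)
    fix f :: "'a \<Rightarrow> real" assume f: "continuous_on UNIV f"
    have f\<alpha>: "continuous_on UNIV (\<lambda>x. f (\<alpha> x))"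
      using continuous_on_compose2[OF f \<alpha>] by simp
    \<comment> \<open>Averages are only asymptotically invariant: the sum telescopes to two end
      terms, hence a defect of at most 2 C f / (n + 1). A closed condition for each e > 0 therefore
      replaces the equation.\<close>
    have "\<bar>L (\<lambda>x. f (\<alpha> x)) - L f\<bar> \<le> e" if e: "0 < e" for e
    proof (intro closed_limit[of "{L. \<bar>L (\<lambda>x. f (\<alpha> x)) - L f\<bar> \<le> e}", simplified])
      show "closed {L. \<bar>L (\<lambda>x. f (\<alpha> x)) - L f\<bar> \<le> e}"
        by (intro closed_Collect_le continuous_intros coord)
      have "\<bar>avg n (\<lambda>x. f (\<alpha> x)) - avg n f\<bar> \<le> 2 * C f / real (Suc n)" for n
      proof -
        have "(\<Sum>k\<le>n. f ((\<alpha> ^^ Suc k) undefined)) - (\<Sum>k\<le>n. f ((\<alpha> ^^ k) undefined))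
            = f ((\<alpha> ^^ Suc n) undefined) - f undefined"
          by (simp only: sum_subtractf[symmetric] sum_telescope'' atMost_atLeast0)
            (induction n; simp)
        then have "avg n (\<lambda>x. f (\<alpha> x)) - avg n f = (f ((\<alpha> ^^ Suc n) undefined) - f undefined) / real (Suc n)"
          using f f\<alpha> by (simp add: avg_def flip: diff_divide_distrib)
        moreover have "\<bar>f ((\<alpha> ^^ Suc n) undefined) - f undefined\<bar> \<le> 2 * C f"
          using C(2)[OF f, of "(\<alpha> ^^ Suc n) undefined"] C(2)[OF f, of undefined] by linarith
        ultimately show ?thesis by (simp add: divide_right_mono)
      qed
      moreover have "\<forall>\<^sub>F n in sequentially. 2 * C f / real (Suc n) < e"
      proof (rule order_tendstoD(2)[OF _ e])
        show "(\<lambda>n. 2 * C f / real (Suc n)) \<longlonglongrightarrow> 0"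
          using LIMSEQ_Suc[OF lim_const_over_n[of "2 * C f"]] by simp
      qed
      ultimately show "\<forall>\<^sub>F n in sequentially. \<bar>avg n (\<lambda>x. f (\<alpha> x)) - avg n f\<bar> \<le> e"
        by (elim eventually_mono) (meson less_imp_le order_trans)
    qed
    then have "\<bar>L (\<lambda>x. f (\<alpha> x)) - L f\<bar> \<le> 0" by (rule field_le_epsilon[where y = 0, simplified])
    then show "L (\<lambda>x. f (\<alpha> x)) = L f" by simp
  qed
qed

text \<open>The image under \<alpha> of the representing measure represents the same functional, so
  uniqueness among regular measures makes the two equal.\<close>

theorem invariant_measures_nonempty:
  fixes \<alpha> :: "'a::t2_space \<Rightarrow> 'a"
  assumes cpt: "compact (UNIV :: 'a set)" and \<alpha>: "continuous_on UNIV \<alpha>"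
  shows "invariant_measures \<alpha> \<noteq> {}"
proof -
  obtain L :: "('a \<Rightarrow> real) \<Rightarrow> real" where L: "positive_functional L" "L (\<lambda>x. 1) = 1"
    "\<And>f. continuous_on UNIV f \<Longrightarrow> L (\<lambda>x. f (\<alpha> x)) = L f"
    using invariant_functional_exists[OF cpt \<alpha>] by metis
  interpret positive_functional L by (rule L(1))
  have "distr riesz_measure borel \<alpha> = riesz_measure"
  proof (rule regular_borel_measure_eqI[OF cpt _ regular_riesz_measure])
    show "regular_borel_measure (distr riesz_measure borel \<alpha>)"
      by (rule regular_borel_measure_distr[OF cpt regular_riesz_measure \<alpha>])
    fix f :: "'a \<Rightarrow> real" assume f: "continuous_on UNIV f"
    have "integral\<^sup>L (distr riesz_measure borel \<alpha>) f = integral\<^sup>L riesz_measure (\<lambda>x. f (\<alpha> x))"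
      by (intro integral_distr measurable_continuous_regular[OF regular_riesz_measure] \<alpha>
          borel_measurable_continuous_onI f)
    also have "\<dots> = L (\<lambda>x. f (\<alpha> x))"
      using continuous_on_compose2[OF f \<alpha>] by (intro riesz_representation) simp
    also have "\<dots> = integral\<^sup>L riesz_measure f"
      by (simp add: riesz_representation L(3) f)
    finally show "integral\<^sup>L (distr riesz_measure borel \<alpha>) f = integral\<^sup>L riesz_measure f" .
  qed
  moreover have "prob_space riesz_measure"
    using finite_measure.emeasure_eq_measure[OF regular_borel_measureD(2)[OF regular_riesz_measure], of UNIV]
      measure_riesz_UNIV L(2) by (intro prob_spaceI) simp
  ultimately have "riesz_measure \<in> invariant_measures \<alpha>"
    using regular_riesz_measure by (simp add: invariant_measures_def)
  then show ?thesis by blast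
qed

section \<open>Invariant measures live on the essential set\<close>

lemma invariant_measuresD:
  assumes "\<mu> \<in> invariant_measures \<alpha>"
  shows "regular_borel_measure \<mu>" "prob_space \<mu>" "distr \<mu> borel \<alpha> = \<mu>"
  using assms by (auto simp: invariant_measures_def)

lemma closed_essential_points: "closed (essential_points \<alpha>)"
proof -
  have "open (- essential_points \<alpha>)"
    by (subst open_subopen) (fastforce simp: essential_points_def)
  then show ?thesis by (simp add: closed_def)
qed

lemma essential_points_forward:
  assumes \<alpha>: "continuous_on UNIV \<alpha>" and x: "x \<in> essential_points \<alpha>"
  shows "\<alpha> x \<in> essential_points \<alpha>"
  unfolding essential_points_def
proof (safe)
  fix V assume V: "open V" "\<alpha> x \<in> V"
  then obtain \<mu> where \<mu>: "\<mu> \<in> invariant_measures \<alpha>" "emeasure \<mu> (\<alpha> -` V) > 0"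
    using x open_vimage[OF V(1) \<alpha>] by (auto simp: essential_points_def)
  note inv = invariant_measuresD[OF \<mu>(1)]
  have "emeasure \<mu> V = emeasure (distr \<mu> borel \<alpha>) V" using inv(3) by simp
  also have "\<dots> = emeasure \<mu> (\<alpha> -` V)"
    using V regular_borel_measureD(3)[OF inv(1)]
    by (subst emeasure_distr[OF measurable_continuous_regular[OF inv(1) \<alpha>]]) auto
  finally show "\<exists>\<mu>\<in>invariant_measures \<alpha>. emeasure \<mu> V > 0"
    using \<mu> by metis
qed

lemma essential_points_funpow:
  assumes "continuous_on UNIV \<alpha>" "x \<in> essential_points \<alpha>"
  shows "(\<alpha> ^^ n) x \<in> essential_points \<alpha>"
  using assms by (induction n) (auto intro: essential_points_forward)

text \<open>Each point outside has a null neighbourhood, but uncountably many of these may be needed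
  to cover the complement. Inner regularity reduces to compact sets, which finitely many of them
  cover.\<close>

lemma AE_essential_points:
  assumes \<mu>: "\<mu> \<in> invariant_measures (\<alpha> :: 'a::t2_space \<Rightarrow> 'a)"
  shows "AE x in \<mu>. x \<in> essential_points \<alpha>"
proof -
  note inv = invariant_measuresD[OF \<mu>]
  note MD = regular_borel_measureD[OF inv(1)]
  interpret prob_space \<mu> by (rule inv)
  have op: "open (- essential_points \<alpha>)" using closed_essential_points by auto
  have "emeasure \<mu> (- essential_points \<alpha>) \<le> 0"
    unfolding regular_borel_measure_SUP[OF inv(1) borel_open[OF op]]
  proof (rule SUP_least)
    fix K assume "K \<in> {K. compact K \<and> K \<subseteq> - essential_points \<alpha>}"
    then have K: "compact K" "K \<subseteq> - essential_points \<alpha>" by auto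
    have "\<exists>V. open V \<and> x \<in> V \<and> emeasure \<mu> V = 0" if "x \<in> K" for x
    proof -
      from that K(2) have "x \<notin> essential_points \<alpha>" by auto
      then obtain V where "open V" "x \<in> V" "\<forall>\<mu>\<in>invariant_measures \<alpha>. \<not> 0 < emeasure \<mu> V"
        unfolding essential_points_def by auto
      with \<mu> show ?thesis using zero_less_iff_neq_zero by metis
    qed
    then obtain V where V: "\<And>x. x \<in> K \<Longrightarrow> open (V x)" "\<And>x. x \<in> K \<Longrightarrow> x \<in> V x"
      "\<And>x. x \<in> K \<Longrightarrow> emeasure \<mu> (V x) = 0" by metis
    then obtain I where I: "I \<subseteq> K" "finite I" "K \<subseteq> (\<Union>x\<in>I. V x)"
    proof -
      have "K \<subseteq> (\<Union>x\<in>K. V x)" using V(2) by auto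
      with V(1) show thesis using compactE_image[OF K(1), of K V] that by metis
    qed
    have "emeasure \<mu> K \<le> emeasure \<mu> (\<Union>x\<in>I. V x)"
      using I V(1) MD(1) by (intro emeasure_mono) (auto intro!: borel_open open_UN)
    also have "\<dots> \<le> (\<Sum>x\<in>I. emeasure \<mu> (V x))"
      using I V MD(1) by (intro emeasure_subadditive_finite) auto
    also have "\<dots> = 0" using I V by (intro sum.neutral) auto
    finally show "emeasure \<mu> K \<le> 0" .
  qed
  then show ?thesis
    using op MD by (intro AE_I[of _ _ "- essential_points \<alpha>"]) auto
qed

text \<open>An invariant probability measure exists and lives on this set. The fact keeps a supremum
  over essential points from degenerating to -\<infinity>.\<close>

lemma essential_points_nonempty:
  fixes \<alpha> :: "'a::t2_space \<Rightarrow> 'a"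
  assumes cpt: "compact (UNIV :: 'a set)" and \<alpha>: "continuous_on UNIV \<alpha>"
  shows "essential_points \<alpha> \<noteq> {}"
proof -
  obtain \<mu> where \<mu>: "\<mu> \<in> invariant_measures \<alpha>" using invariant_measures_nonempty[OF cpt \<alpha>] by blast
  interpret prob_space \<mu> by (rule invariant_measuresD[OF \<mu>])
  show ?thesis using AE_essential_points[OF \<mu>] AE_False by force
qed

lemma distr_funpow_invariant:
  assumes \<mu>: "\<mu> \<in> invariant_measures \<alpha>" and \<alpha>: "continuous_on UNIV \<alpha>"
  shows "distr \<mu> borel (\<alpha> ^^ n) = \<mu>"
proof (induction n)
  note inv = invariant_measuresD[OF \<mu>]
  case 0
  show ?case using distr_id2[of borel \<mu>] regular_borel_measureD(1)[OF inv(1)] by (simp add: id_def)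
next
  note inv = invariant_measuresD[OF \<mu>]
  case (Suc n)
  have "distr \<mu> borel (\<alpha> ^^ Suc n) = distr (distr \<mu> borel (\<alpha> ^^ n)) borel \<alpha>"
    by (subst distr_distr)
      (auto intro: measurable_continuous_regular[OF inv(1)] funpow_continuous \<alpha> borel_measurable_continuous_onI)
  then show ?case using Suc inv(3) by metis
qed

lemma invariant_funpow:
  fixes f :: "'a::t2_space \<Rightarrow> real"
  assumes \<mu>: "\<mu> \<in> invariant_measures \<alpha>" and \<alpha>: "continuous_on UNIV \<alpha>"
  shows "f \<in> borel_measurable borel \<Longrightarrow> integral\<^sup>L \<mu> (\<lambda>x. f ((\<alpha> ^^ n) x)) = integral\<^sup>L \<mu> f"
    and "f \<in> borel_measurable borel \<Longrightarrow> integrable \<mu> f \<Longrightarrow> integrable \<mu> (\<lambda>x. f ((\<alpha> ^^ n) x))"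
    and "AE x in \<mu>. P x \<Longrightarrow> AE x in \<mu>. P ((\<alpha> ^^ n) x)"
proof -
  note m = measurable_continuous_regular[OF invariant_measuresD(1)[OF \<mu>] funpow_continuous[OF \<alpha>]]
  note d = distr_funpow_invariant[OF \<mu> \<alpha>]
  show "integral\<^sup>L \<mu> (\<lambda>x. f ((\<alpha> ^^ n) x)) = integral\<^sup>L \<mu> f" if "f \<in> borel_measurable borel"
    using integral_distr[OF m that, of n] d by simp
  show "integrable \<mu> (\<lambda>x. f ((\<alpha> ^^ n) x))" if "f \<in> borel_measurable borel" "integrable \<mu> f"
    using integrable_distr_eq[OF m that(1), of n] d that(2) by simp
  show "AE x in \<mu>. P ((\<alpha> ^^ n) x)" if "AE x in \<mu>. P x"
    by (rule AE_distrD[OF m]) (simp only: d that)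
qed

section \<open>Transfer operators\<close>

locale compact_transfer_operator =
  fixes \<alpha> :: "'a::t2_space \<Rightarrow> 'a" and A :: "('a \<Rightarrow> real) \<Rightarrow> 'a \<Rightarrow> real"
  assumes compact_UNIV: "compact (UNIV :: 'a set)"
    and continuous_\<alpha>: "continuous_on UNIV \<alpha>"
    and transfer_operator: "transfer_operator \<alpha> A"
begin

lemma continuous_A: "continuous_on UNIV f \<Longrightarrow> continuous_on UNIV (A f)"
  using transfer_operator by (simp add: transfer_operator_def)

lemma A_comp_mult:
  "continuous_on UNIV f \<Longrightarrow> continuous_on UNIV g \<Longrightarrow> A (\<lambda>x. f (\<alpha> x) * g x) = (\<lambda>x. f x * A g x)"
  using transfer_operator by (simp add: transfer_operator_def)

sublocale A: positive_functional "\<lambda>f. A f x" for x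
  using transfer_operator compact_UNIV
  by unfold_locales (auto simp: transfer_operator_def)

text \<open>Existence by the Riesz theorem and uniqueness among regular measures justify the
  definite description in \<open>operator_measure\<close>.\<close>

lemma operator_measure_unique:
  "regular_borel_measure (operator_measure A x) \<and>
    (\<forall>f. continuous_on UNIV f \<longrightarrow> integral\<^sup>L (operator_measure A x) f = A f x)"
  unfolding operator_measure_def
proof (rule theI[of _ "A.riesz_measure x"])
  show "regular_borel_measure (A.riesz_measure x) \<and>
      (\<forall>f. continuous_on UNIV f \<longrightarrow> integral\<^sup>L (A.riesz_measure x) f = A f x)"
    using A.regular_riesz_measure A.riesz_representation by blast
  then show "M = A.riesz_measure x"
    if "regular_borel_measure M \<and> (\<forall>f. continuous_on UNIV f \<longrightarrow> integral\<^sup>L M f = A f x)" for M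
    using that by (intro regular_borel_measure_eqI[OF compact_UNIV]) auto
qed

lemma regular_operator_measure: "regular_borel_measure (operator_measure A x)"
  using operator_measure_unique by blast

lemma integral_operator_measure:
  "continuous_on UNIV f \<Longrightarrow> integral\<^sup>L (operator_measure A x) f = A f x"
  using operator_measure_unique by blast

lemma finite_operator_measure: "finite_measure (operator_measure A x)"
  and sets_operator_measure [measurable_cong]: "sets (operator_measure A x) = sets borel"
  and space_operator_measure: "space (operator_measure A x) = UNIV"
  using regular_borel_measureD[OF regular_operator_measure] by auto

lemma integrable_operator_measure:
  "continuous_on UNIV f \<Longrightarrow> integrable (operator_measure A x) (f :: 'a \<Rightarrow> real)"
  by (rule integrable_continuous_compact[OF compact_UNIV regular_operator_measure])

text \<open>If h vanishes at x, then A (h o \<alpha>) x = h(x) A 1 x = 0 by the transfer identity.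
  With h = 1 on the image of a compact K off the fibre, K is null, and inner regularity of the open
  complement of the fibre finishes.\<close>

lemma operator_measure_fibre: "AE y in operator_measure A x. \<alpha> y = x"
proof -
  interpret finite_measure "operator_measure A x" by (rule finite_operator_measure)
  define B where "B = - (\<alpha> -` {x})"
  have B: "open B" unfolding B_def using closed_vimage[OF _ continuous_\<alpha>, of "{x}"] by auto
  have "measure (operator_measure A x) B \<le> 0"
  proof (rule field_le_epsilon)
    fix e :: real assume e: "0 < e"
    obtain K where K: "compact K" "K \<subseteq> B" "measure (operator_measure A x) B \<le> measure (operator_measure A x) K + e"
      using regular_borel_measure_innerD[OF regular_operator_measure _ e] borel_open[OF B] by metis
    have "compact (\<alpha> ` K)"
      using compact_continuous_image[OF continuous_on_subset[OF continuous_\<alpha>] K(1)] by simp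
    then have "closed (\<alpha> ` K)" by (rule compact_imp_closed)
    moreover have "{x} \<inter> \<alpha> ` K = {}" using K(2) by (auto simp: B_def)
    ultimately obtain h where h: "continuous_on UNIV h" "\<And>y. 0 \<le> h y" "\<And>y. h y \<le> 1"
      "\<And>y. y \<in> {x} \<Longrightarrow> h y = 0" "\<And>y. y \<in> \<alpha> ` K \<Longrightarrow> h y = (1::real)"
      using urysohn_compact[OF compact_UNIV, of "{x}" "\<alpha> ` K"] by (metis closed_singleton)
    have h\<alpha>: "continuous_on UNIV (\<lambda>y. h (\<alpha> y))"
      using continuous_on_compose2[OF h(1) continuous_\<alpha>] by simp
    have "measure (operator_measure A x) K \<le> integral\<^sup>L (operator_measure A x) (\<lambda>y. h (\<alpha> y))"
      using h K(1) by (intro measure_le_integral[OF compact_UNIV regular_operator_measure h\<alpha>])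
        (auto simp: compact_imp_closed)
    also have "\<dots> = A (\<lambda>y. h (\<alpha> y) * 1) x"
      by (simp add: integral_operator_measure[OF h\<alpha>])
    also have "\<dots> = 0"
      using A_comp_mult[OF h(1) continuous_on_const, of 1] h(4) by (simp add: fun_eq_iff)
    finally show "measure (operator_measure A x) B \<le> 0 + e" using K(3) by simp
  qed
  then have "emeasure (operator_measure A x) B = 0"
    using measure_nonneg[of "operator_measure A x" B] by (simp add: emeasure_eq_measure)
  then show ?thesis
    using B by (intro AE_I[of _ _ B]) (auto simp: B_def sets_operator_measure)
qed

lemma cocycle_nonneg: "0 \<le> cocycle \<alpha> A y"
  by (simp add: cocycle_def)

text \<open>Of the integral of f against the measure attached to \<open>\<alpha> y\<close>, only the
  atom at y is kept.\<close>

lemma cocycle_mult_le: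
  assumes f: "continuous_on UNIV f" "\<And>x. 0 \<le> f x"
  shows "cocycle \<alpha> A y * f y \<le> A f (\<alpha> y)"
proof -
  interpret finite_measure "operator_measure A (\<alpha> y)" by (rule finite_operator_measure)
  have "cocycle \<alpha> A y * f y = (\<integral>z. indicator {y} z * f y \<partial>operator_measure A (\<alpha> y))"
    by (simp add: cocycle_def space_operator_measure)
  also have "\<dots> \<le> (\<integral>z. f z \<partial>operator_measure A (\<alpha> y))"
  proof (rule integral_mono)
    show "integrable (operator_measure A (\<alpha> y)) (\<lambda>z. indicator {y} z * f y)"
      by (intro integrable_mult_left)
        (auto simp: integrable_indicator_iff emeasure_eq_measure sets_operator_measure)
    show "indicator {y} z * f y \<le> f z" for z using f(2) by (simp add: indicator_def)
  qed (rule integrable_operator_measure[OF f(1)])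
  also have "\<dots> = A f (\<alpha> y)" by (rule integral_operator_measure[OF f(1)])
  finally show ?thesis .
qed

text \<open>nu_x is carried by the fibre over x, so its restriction to the essential set is a finite
  sum of atoms, and the cocycle is their mass.\<close>

lemma set_integral_operator_measure:
  fixes f :: "'a \<Rightarrow> real"
  assumes f: "continuous_on UNIV f" and fin: "finite (essential_preimage \<alpha> 1 x)"
  shows "set_lebesgue_integral (operator_measure A x) (essential_points \<alpha>) f =
    (\<Sum>y\<in>essential_preimage \<alpha> 1 x. cocycle \<alpha> A y * f y)"
proof -
  let ?P = "essential_preimage \<alpha> 1 x" and ?\<nu> = "operator_measure A x"
  interpret finite_measure ?\<nu> by (rule finite_operator_measure)
  have [measurable]: "f \<in> borel_measurable borel" by (rule borel_measurable_continuous_onI[OF f])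
  have [measurable]: "essential_points \<alpha> \<in> sets borel" by (simp add: closed_essential_points)
  have [measurable]: "{y} \<in> sets (borel :: 'a measure)" for y by simp
  have "set_lebesgue_integral ?\<nu> (essential_points \<alpha>) f = (\<integral>z. (\<Sum>y\<in>?P. indicator {y} z * f y) \<partial>?\<nu>)"
    unfolding set_lebesgue_integral_def
  proof (rule integral_cong_AE)
    show "AE z in ?\<nu>. indicator (essential_points \<alpha>) z *\<^sub>R f z = (\<Sum>y\<in>?P. indicator {y} z * f y)"
      using operator_measure_fibre
    proof eventually_elim
      case (elim z)
      have "(\<Sum>y\<in>?P. indicator {y} z * f y) = (\<Sum>y\<in>?P. if y = z then f y else 0)"
        by (intro sum.cong) (auto simp: indicator_def)
      also have "\<dots> = (if z \<in> ?P then f z else 0)" using fin by simp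
      finally show ?case using elim by (simp add: essential_preimage_def indicator_def)
    qed
  qed measurable
  also have "\<dots> = (\<Sum>y\<in>?P. \<integral>z. indicator {y} z * f y \<partial>?\<nu>)"
    by (intro Bochner_Integration.integral_sum integrable_mult_left)
      (auto simp: integrable_indicator_iff emeasure_eq_measure sets_operator_measure)
  also have "\<dots> = (\<Sum>y\<in>?P. cocycle \<alpha> A y * f y)"
    by (intro sum.cong) (auto simp: cocycle_def space_operator_measure essential_preimage_def)
  finally show ?thesis .
qed

section \<open>Iterates of A, weighted iterates and the count of preimages\<close>

lemma iterate_continuous: "continuous_on UNIV f \<Longrightarrow> continuous_on UNIV ((A ^^ n) f)"
  by (induction n) (auto intro: continuous_A)

lemma iterate_nonneg:
  "continuous_on UNIV f \<Longrightarrow> (\<And>x. 0 \<le> f x) \<Longrightarrow> 0 \<le> (A ^^ n) f x"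
  by (induction n arbitrary: x) (auto intro: A.nonneg iterate_continuous)

lemma positive_functional_iterate:
  assumes \<mu>: "regular_borel_measure \<mu>"
  shows "positive_functional (\<lambda>f. integral\<^sup>L \<mu> ((A ^^ n) f))"
proof
  note int = integrable_continuous_compact[OF compact_UNIV \<mu> iterate_continuous]
  have "(A ^^ n) (\<lambda>x. f x + g x) = (\<lambda>x. (A ^^ n) f x + (A ^^ n) g x)"
    if "continuous_on UNIV f" "continuous_on UNIV g" for f g
  proof (induction n)
    case (Suc n)
    show ?case
      using A.add[OF iterate_continuous[OF that(1)] iterate_continuous[OF that(2)]]
      by (intro ext) (simp add: Suc)
  qed simp
  then show "integral\<^sup>L \<mu> ((A ^^ n) (\<lambda>x. f x + g x)) = integral\<^sup>L \<mu> ((A ^^ n) f) + integral\<^sup>L \<mu> ((A ^^ n) g)"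
    if "continuous_on UNIV f" "continuous_on UNIV g" for f g
    using that int by simp
  have "(A ^^ n) (\<lambda>x. c * f x) = (\<lambda>x. c * (A ^^ n) f x)"
    if "continuous_on UNIV f" for f c
  proof (induction n)
    case (Suc n)
    show ?case using A.scale[OF iterate_continuous[OF that(1)]] by (intro ext) (simp add: Suc)
  qed simp
  then show "integral\<^sup>L \<mu> ((A ^^ n) (\<lambda>x. c * f x)) = c * integral\<^sup>L \<mu> ((A ^^ n) f)"
    if "continuous_on UNIV f" for f c
    using that int by simp
  show "0 \<le> integral\<^sup>L \<mu> ((A ^^ n) f)" if "continuous_on UNIV f" "\<And>x. 0 \<le> f x" for f
    using that by (intro integral_nonneg_AE) (auto intro: iterate_nonneg)
qed (rule compact_UNIV)

lemma prod_cocycle_mult_le: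
  assumes f: "continuous_on UNIV f" "\<And>x. 0 \<le> f x"
  shows "(\<Prod>i<n. cocycle \<alpha> A ((\<alpha> ^^ i) y)) * f y \<le> (A ^^ n) f ((\<alpha> ^^ n) y)"
proof (induction n)
  case (Suc n)
  have "(\<Prod>i<Suc n. cocycle \<alpha> A ((\<alpha> ^^ i) y)) * f y
      \<le> cocycle \<alpha> A ((\<alpha> ^^ n) y) * (A ^^ n) f ((\<alpha> ^^ n) y)"
    using mult_left_mono[OF Suc cocycle_nonneg[of "(\<alpha> ^^ n) y"]] by (simp add: mult_ac)
  also have "\<dots> \<le> A ((A ^^ n) f) (\<alpha> ((\<alpha> ^^ n) y))"
    by (intro cocycle_mult_le iterate_continuous iterate_nonneg f)
  finally show ?case by simp
qed simp

text \<open>The transfer identity A((f o \<alpha>) g) = f A g pulls the factors w o \<alpha>^i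
  through A, so a weight accumulated along the orbit becomes one factor w per application.\<close>

lemma iterate_weighted:
  assumes w: "continuous_on UNIV w" and f: "continuous_on UNIV f"
  shows "(A ^^ n) (\<lambda>x. (\<Prod>i<n. w ((\<alpha> ^^ i) x)) * f x) = ((\<lambda>f. A (\<lambda>x. w x * f x)) ^^ n) f"
  using f
proof (induction n arbitrary: f)
  case (Suc n)
  have wf: "continuous_on UNIV (\<lambda>x. w x * f x)" by (intro continuous_intros w Suc.prems)
  have W: "continuous_on UNIV (\<lambda>x. \<Prod>i<n. w ((\<alpha> ^^ i) x))"
    using continuous_on_compose2[OF w funpow_continuous[OF continuous_\<alpha>]]
    by (intro continuous_on_prod) simp
  have "((\<lambda>f. A (\<lambda>x. w x * f x)) ^^ Suc n) f = ((\<lambda>f. A (\<lambda>x. w x * f x)) ^^ n) (A (\<lambda>x. w x * f x))"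
    by (simp only: funpow_Suc_right comp_apply)
  also have "\<dots> = (A ^^ n) (\<lambda>x. (\<Prod>i<n. w ((\<alpha> ^^ i) x)) * A (\<lambda>x. w x * f x) x)"
    by (rule Suc.IH[symmetric, OF continuous_A[OF wf]])
  also have "\<dots> = (A ^^ n) (A (\<lambda>x. (\<Prod>i<n. w ((\<alpha> ^^ i) (\<alpha> x))) * (w x * f x)))"
    by (subst A_comp_mult[OF W wf]) (rule refl)
  also have "(\<lambda>x. (\<Prod>i<n. w ((\<alpha> ^^ i) (\<alpha> x))) * (w x * f x)) = (\<lambda>x. (\<Prod>i<Suc n. w ((\<alpha> ^^ i) x)) * f x)"
    by (simp add: prod.lessThan_Suc_shift funpow_swap1 fun_eq_iff mult_ac del: prod.lessThan_Suc)
  also have "(A ^^ n) (A (\<lambda>x. (\<Prod>i<Suc n. w ((\<alpha> ^^ i) x)) * f x)) = (A ^^ Suc n) (\<lambda>x. (\<Prod>i<Suc n. w ((\<alpha> ^^ i) x)) * f x)"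
    by (simp only: funpow_Suc_right comp_apply)
  finally show ?case by simp
qed simp

text \<open>nu_x is split at the essential set. Inside, rho w \<le> 1 leaves the plain sum over
  preimages; outside, w f \<le> c b h, and the mass of h there is A h x - nu_x(X_\<alpha>) \<le>
  d.\<close>

lemma weighted_le_sum:
  fixes w h f :: "'a \<Rightarrow> real"
  assumes fin: "finite (essential_preimage \<alpha> 1 x)"
    and w: "continuous_on UNIV w" "\<And>y. 0 \<le> w y" "\<And>y. w y \<le> b * h y"
      "\<And>y. y \<in> essential_points \<alpha> \<Longrightarrow> cocycle \<alpha> A y * w y \<le> 1"
    and h: "continuous_on UNIV h" "\<And>y. y \<in> essential_points \<alpha> \<Longrightarrow> h y = 1"
      "A h x - measure (operator_measure A x) (essential_points \<alpha>) \<le> d"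
    and f: "continuous_on UNIV f" "\<And>y. 0 \<le> f y" "\<And>y. f y \<le> c" and b: "0 \<le> b"
  shows "A (\<lambda>y. w y * f y) x \<le> (\<Sum>y\<in>essential_preimage \<alpha> 1 x. f y) + c * b * d"
proof -
  let ?\<nu> = "operator_measure A x" and ?E = "essential_points \<alpha>"
  interpret finite_measure ?\<nu> by (rule finite_operator_measure)
  have c: "0 \<le> c" using f(2,3) order_trans by blast
  have E: "?E \<in> sets ?\<nu>" by (simp add: closed_essential_points sets_operator_measure)
  have wf: "continuous_on UNIV (\<lambda>y. w y * f y)" by (intro continuous_intros w f)
  have iE: "integrable ?\<nu> (\<lambda>y. indicator ?E y *\<^sub>R (w y * f y))"
    by (rule integrable_mult_indicator[OF E integrable_operator_measure[OF wf]])
  have i1: "integrable ?\<nu> (\<lambda>y. indicator ?E y :: real)"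
    using E by (simp add: integrable_indicator_iff emeasure_eq_measure)
  have ih: "integrable ?\<nu> (\<lambda>y. c * b * (h y - indicator ?E y))"
    by (intro integrable_mult_right Bochner_Integration.integrable_diff i1 integrable_operator_measure h)
  have "A (\<lambda>y. w y * f y) x = (\<integral>y. w y * f y \<partial>?\<nu>)" by (rule integral_operator_measure[OF wf, symmetric])
  also have "\<dots> \<le> (\<integral>y. indicator ?E y *\<^sub>R (w y * f y) + c * b * (h y - indicator ?E y) \<partial>?\<nu>)"
  proof (rule integral_mono)
    fix y
    have "w y * f y \<le> b * h y * c"
      using w(2,3)[of y] f(2,3)[of y] by (intro mult_mono) auto
    then show "w y * f y \<le> indicator ?E y *\<^sub>R (w y * f y) + c * b * (h y - indicator ?E y)"
      using h(2)[of y] by (cases "y \<in> ?E") (auto simp: mult_ac)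
  qed (intro Bochner_Integration.integrable_add iE ih integrable_operator_measure[OF wf])+
  also have "\<dots> = set_lebesgue_integral ?\<nu> ?E (\<lambda>y. w y * f y) + c * b * (A h x - measure ?\<nu> ?E)"
    unfolding set_lebesgue_integral_def Bochner_Integration.integral_add[OF iE ih]
    using Bochner_Integration.integral_diff[OF integrable_operator_measure[OF h(1)] i1]
    by (simp add: integral_operator_measure[OF h(1)] space_operator_measure)
  also have "\<dots> \<le> set_lebesgue_integral ?\<nu> ?E (\<lambda>y. w y * f y) + c * b * d"
    using c b h(3) by (intro add_left_mono mult_left_mono) auto
  also have "set_lebesgue_integral ?\<nu> ?E (\<lambda>y. w y * f y) = (\<Sum>y\<in>essential_preimage \<alpha> 1 x. cocycle \<alpha> A y * (w y * f y))"
    by (rule set_integral_operator_measure[OF wf fin])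
  also have "\<dots> \<le> (\<Sum>y\<in>essential_preimage \<alpha> 1 x. f y)"
  proof (rule sum_mono)
    fix y assume "y \<in> essential_preimage \<alpha> 1 x"
    then show "cocycle \<alpha> A y * (w y * f y) \<le> f y"
      using mult_right_mono[OF w(4)[of y] f(2)[of y]] by (simp add: essential_preimage_def mult_ac)
  qed
  finally show ?thesis by simp
qed

text \<open>The last orbit step before x is split off, matching the outermost application of the
  operator; forward invariance of the essential set makes the intermediate point essential.\<close>

lemma essential_preimage_Suc:
  "essential_preimage \<alpha> (Suc n) x = (\<Union>y\<in>essential_preimage \<alpha> 1 x. essential_preimage \<alpha> n y)"
  using essential_points_funpow[OF continuous_\<alpha>] by (auto simp: essential_preimage_def)

lemma finite_essential_preimage:
  assumes "\<And>x. x \<in> essential_points \<alpha> \<Longrightarrow> finite (essential_preimage \<alpha> 1 x)" "x \<in> essential_points \<alpha>"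
  shows "finite (essential_preimage \<alpha> n x)"
  using assms(2)
proof (induction n arbitrary: x)
  case 0
  have "essential_preimage \<alpha> 0 x \<subseteq> {x}" by (auto simp: essential_preimage_def)
  then show ?case by (rule finite_subset) simp
next
  case (Suc n)
  show ?case unfolding essential_preimage_Suc
    using Suc assms(1) by (auto simp: essential_preimage_def)
qed

lemma card_essential_preimage_Suc:
  assumes "\<And>x. x \<in> essential_points \<alpha> \<Longrightarrow> finite (essential_preimage \<alpha> 1 x)" "x \<in> essential_points \<alpha>"
  shows "card (essential_preimage \<alpha> (Suc n) x) = (\<Sum>y\<in>essential_preimage \<alpha> 1 x. card (essential_preimage \<alpha> n y))"
  unfolding essential_preimage_Suc
  using assms finite_essential_preimage[OF assms(1)]
  by (intro card_UN_disjoint) (auto simp: essential_preimage_def)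

text \<open>
  Iterating the weighted operator adds, besides the number of preimages, only the mass that leaks
  out of the essential set, which is linear in the leak \<open>d\<close> of a single step.
\<close>

lemma weighted_iterate_le_card:
  fixes w h :: "'a \<Rightarrow> real"
  assumes fin: "\<And>x. x \<in> essential_points \<alpha> \<Longrightarrow> finite (essential_preimage \<alpha> 1 x)"
    and card: "\<And>x. x \<in> essential_points \<alpha> \<Longrightarrow> real (card (essential_preimage \<alpha> 1 x)) \<le> N"
    and w: "continuous_on UNIV w" "\<And>y. 0 \<le> w y" "\<And>y. w y \<le> b * h y"
      "\<And>y. y \<in> essential_points \<alpha> \<Longrightarrow> cocycle \<alpha> A y * w y \<le> 1"
    and h: "continuous_on UNIV h" "\<And>y. y \<in> essential_points \<alpha> \<Longrightarrow> h y = 1"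
      "\<And>x. x \<in> essential_points \<alpha> \<Longrightarrow> A h x - measure (operator_measure A x) (essential_points \<alpha>) \<le> d"
    and C: "\<And>x. A w x \<le> C" "0 \<le> C" and b: "0 \<le> b" and N: "0 \<le> N" and d: "0 \<le> d"
  shows "x \<in> essential_points \<alpha> \<Longrightarrow> ((\<lambda>f. A (\<lambda>x. w x * f x)) ^^ n) (\<lambda>x. 1) x
    \<le> real (card (essential_preimage \<alpha> n x)) + rec_nat 0 (\<lambda>k c. N * c + C ^ k * b) n * d"
proof (induction n arbitrary: x)
  case 0
  have "essential_preimage \<alpha> 0 x = {x}" using 0 by (auto simp: essential_preimage_def)
  then show ?case by simp
next
  case (Suc n)
  \<comment> \<open>c n is the total leak after n steps per unit of d. The leak so far is inherited
    from at most N essential preimages, and C ^ k * b is the new leak of one step, by the a priori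
    bound C ^ k on the k-th iterate proved next.\<close>
  define c where "c = rec_nat (0::real) (\<lambda>k c. N * c + C ^ k * b)"
  define F where "F = (\<lambda>n. ((\<lambda>f. A (\<lambda>x. w x * f x)) ^^ n) (\<lambda>x. 1))"
  have F: "continuous_on UNIV (F k) \<and> (\<forall>y. 0 \<le> F k y \<and> F k y \<le> C ^ k)" for k
  proof (induction k)
    case (Suc k)
    have wF: "continuous_on UNIV (\<lambda>x. w x * F k x)" using Suc w by (intro continuous_intros) auto
    have Fs: "F (Suc k) = A (\<lambda>x. w x * F k x)" by (simp add: F_def)
    have "A (\<lambda>x. w x * F k x) y \<le> A (\<lambda>x. C ^ k * w x) y" for y
      using Suc w wF by (intro A.mono) (auto intro!: continuous_intros simp: mult.commute mult_left_mono)
    also have "A (\<lambda>x. C ^ k * w x) y \<le> C ^ k * C" for y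
      unfolding A.scale[OF w(1)] using C by (intro mult_left_mono) auto
    finally show ?case unfolding Fs
      using Suc w wF by (auto intro!: continuous_A A.nonneg simp: mult.commute)
  qed (simp add: F_def)
  have c0: "0 \<le> c k" for k using N C b by (induction k) (auto simp: c_def)
  have card_Suc: "real (card (essential_preimage \<alpha> (Suc n) x))
      = (\<Sum>y\<in>essential_preimage \<alpha> 1 x. real (card (essential_preimage \<alpha> n y)))"
    using card_essential_preimage_Suc[OF fin Suc.prems, of n] by simp
  have fx: "finite (essential_preimage \<alpha> 1 x)" by (rule fin[OF Suc.prems])
  have "F (Suc n) x = A (\<lambda>y. w y * F n y) x" by (simp add: F_def)
  also have "\<dots> \<le> (\<Sum>y\<in>essential_preimage \<alpha> 1 x. F n y) + C ^ n * b * d"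
    using F[of n] by (intro weighted_le_sum[OF fx w h(1,2) h(3)[OF Suc.prems] _ _ _ b]) auto
  also have "(\<Sum>y\<in>essential_preimage \<alpha> 1 x. F n y)
      \<le> (\<Sum>y\<in>essential_preimage \<alpha> 1 x. real (card (essential_preimage \<alpha> n y)) + c n * d)"
    unfolding F_def c_def by (intro sum_mono Suc.IH) (simp add: essential_preimage_def)
  also have "\<dots> = real (card (essential_preimage \<alpha> (Suc n) x)) + real (card (essential_preimage \<alpha> 1 x)) * (c n * d)"
    unfolding card_Suc by (simp add: sum.distrib)
  also have "\<dots> \<le> real (card (essential_preimage \<alpha> (Suc n) x)) + N * (c n * d)"
    using c0 d by (intro add_left_mono mult_right_mono card Suc.prems) auto
  finally have "F (Suc n) x \<le> real (card (essential_preimage \<alpha> (Suc n) x)) + c (Suc n) * d"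
    by (simp add: c_def algebra_simps)
  then show ?case unfolding F_def c_def .
qed

text \<open>
  Dini's argument: the masses \<open>\<nu>\<^sub>x(U)\<close> of neighbourhoods \<open>U\<close> of the essential set decrease to
  \<open>\<nu>\<^sub>x\<close> of that set, and compatibility makes the limit continuous, so the convergence is uniform.
\<close>

lemma uniform_cutoff:
  assumes compat: "essentially_compatible \<alpha> A" and d: "0 < d"
  obtains h :: "'a \<Rightarrow> real" where "continuous_on UNIV h" "\<And>y. 0 < h y"
    "\<And>y. h y \<le> 1" "\<And>y. y \<in> essential_points \<alpha> \<Longrightarrow> h y = 1"
    "\<And>x. x \<in> essential_points \<alpha> \<Longrightarrow> A h x - measure (operator_measure A x) (essential_points \<alpha>) \<le> d"
proof -
  let ?E = "essential_points \<alpha>"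
  define m where "m = (\<lambda>x. measure (operator_measure A x) ?E)"
  have E: "closed ?E" by (rule closed_essential_points)
  have m: "continuous_on ?E m"
  proof -
    have "continuous_on ?E (\<lambda>x. set_lebesgue_integral (operator_measure A x) ?E (\<lambda>y. 1 :: real))"
      using compat unfolding essentially_compatible_def by (metis continuous_on_const)
    then show ?thesis
      by (simp add: m_def set_lebesgue_integral_def space_operator_measure)
  qed
  \<comment> \<open>k is a cutoff that works at x, and T a neighbourhood to which continuity of A k
    - m carries the estimate. Continuity of m is compatibility applied to the constant 1.\<close>
  define good where "good = (\<lambda>x k T. continuous_on UNIV k \<and> (\<forall>y. 0 \<le> k y \<and> k y \<le> 1) \<and> (\<forall>y\<in>?E. k y = (1::real)) \<and>
      open T \<and> x \<in> T \<and> (\<forall>y\<in>?E \<inter> T. A k y - m y < d / 2))"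
  have "\<exists>k T. good x k T" if x: "x \<in> ?E" for x
  proof -
    obtain U where U: "open U" "?E \<subseteq> U" "measure (operator_measure A x) U \<le> m x + d / 4"
      using regular_borel_measure_outerD[OF regular_operator_measure borel_closed[OF E], of "d / 4"]
        divide_pos_pos[OF d zero_less_numeral] unfolding m_def by metis
    obtain k where k: "continuous_on UNIV k" "\<And>y. 0 \<le> k y" "\<And>y. k y \<le> 1"
      "\<And>y. y \<in> - U \<Longrightarrow> k y = 0" "\<And>y. y \<in> ?E \<Longrightarrow> k y = (1::real)"
      using urysohn_compact[OF compact_UNIV, of "- U" ?E] U(1,2) E closed_Compl[OF U(1)]
      by (metis disjoint_eq_subset_Compl compl_le_compl_iff)
    have "A k x \<le> measure (operator_measure A x) U"
      using integral_le_measure[OF compact_UNIV regular_operator_measure k(1), of U x] k U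
        integral_operator_measure[OF k(1), of x] by auto
    then have less: "A k x - m x < d / 2" using U d by simp
    have "continuous_on ?E (\<lambda>y. A k y - m y)"
      by (intro continuous_intros m continuous_on_subset[OF continuous_A[OF k(1)]]) auto
    then obtain T where T: "open T" "T \<inter> ?E = (\<lambda>y. A k y - m y) -` {..<d/2} \<inter> ?E"
      unfolding continuous_on_open_invariant by (metis open_lessThan)
    have "x \<in> T" "\<forall>y\<in>?E \<inter> T. A k y - m y < d / 2"
      using T(2) less x by auto
    with k T(1) have "good x k T" unfolding good_def by auto
    then show ?thesis by blast
  qed
  then obtain k T where good: "\<And>x. x \<in> ?E \<Longrightarrow> good x (k x) (T x)" by metis
  have k: "\<And>x. x \<in> ?E \<Longrightarrow> continuous_on UNIV (k x)"
      "\<And>x y. x \<in> ?E \<Longrightarrow> 0 \<le> k x y" "\<And>x y. x \<in> ?E \<Longrightarrow> k x y \<le> 1"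
      "\<And>x y. x \<in> ?E \<Longrightarrow> y \<in> ?E \<Longrightarrow> k x y = (1::real)"
    and T: "\<And>x. x \<in> ?E \<Longrightarrow> open (T x)" "\<And>x. x \<in> ?E \<Longrightarrow> x \<in> T x"
      "\<And>x y. x \<in> ?E \<Longrightarrow> y \<in> ?E \<Longrightarrow> y \<in> T x \<Longrightarrow> A (k x) y - m y < d / 2"
    using good unfolding good_def by blast+
  have "compact ?E" using E compact_eq_closed_compact_space[OF compact_UNIV] by blast
  moreover have "?E \<subseteq> (\<Union>x\<in>?E. T x)" using T(2) by auto
  ultimately obtain I where I: "I \<subseteq> ?E" "finite I" "?E \<subseteq> (\<Union>x\<in>I. T x)"
    using compactE_image[of ?E ?E T] T(1) by metis
  \<comment> \<open>A product of factors in [0, 1] lies below each factor, so K inherits all the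
    local estimates at once.\<close>
  define K where "K = (\<lambda>y. \<Prod>x\<in>I. k x y)"
  have Kc: "continuous_on UNIV K" unfolding K_def using k(1) I by (intro continuous_on_prod) auto
  have K01: "0 \<le> K y" "K y \<le> 1" for y
    unfolding K_def using k(2,3) I(1) by (auto intro!: prod_nonneg prod_le_1)
  have KE: "K y = 1" if "y \<in> ?E" for y
    unfolding K_def using k(4)[OF _ that] I(1) by (intro prod.neutral) auto
  have Kd: "A K x - m x < d / 2" if x: "x \<in> ?E" for x
  proof -
    obtain z where z: "z \<in> I" "x \<in> T z" using I(3) x by auto
    then have zE: "z \<in> ?E" using I(1) by auto
    have "K y \<le> k z y" for y
    proof -
      have "K y = k z y * (\<Prod>x\<in>I - {z}. k x y)"
        unfolding K_def by (rule prod.remove[OF I(2) z(1)])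
      moreover have "(\<Prod>x\<in>I - {z}. k x y) \<le> 1"
        using k(2,3) I(1) by (intro prod_le_1) auto
      ultimately show ?thesis using k(2)[OF zE, of y] by (simp add: mult_left_le)
    qed
    then have "A K x \<le> A (k z) x" by (intro A.mono Kc k zE)
    with T(3)[OF zE x z(2)] show ?thesis by simp
  qed
  obtain c where c: "0 < c" "\<And>x. \<bar>A (\<lambda>x. 1) x\<bar> \<le> c"
    using bounded_continuous_compact[OF compact_UNIV continuous_A[OF continuous_on_const]] by metis
  \<comment> \<open>Adding t makes h strictly positive, as the logarithm of the weight requires, and
    costs at most t * c = d / 2; dividing by 1 + t restores the value 1 on the essential
    set.\<close>
  define t where "t = d / (2 * c)"
  have t: "0 < t" "t * c = d / 2" using c(1) d by (auto simp: t_def)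
  define h where "h = (\<lambda>y. (K y + t) / (1 + t))"
  have hc: "continuous_on UNIV h"
    unfolding h_def using t by (intro continuous_intros Kc) auto
  show thesis
  proof (rule that[of h])
    show "continuous_on UNIV h" by (rule hc)
    show "0 < h y" "h y \<le> 1" for y
      using K01[of y] t(1) by (auto simp: h_def field_simps intro!: divide_pos_pos add_nonneg_pos)
    show "h y = 1" if "y \<in> ?E" for y using KE[OF that] t(1) by (simp add: h_def)
    fix x assume x: "x \<in> ?E"
    have "h y \<le> K y + t" for y
      using K01(1)[of y] t(1) by (simp add: h_def field_simps)
    then have "A h x \<le> A (\<lambda>y. K y + t) x"
      using t by (intro A.mono hc continuous_intros Kc)
    also have "\<dots> = A K x + t * A (\<lambda>y. 1) x"
      using A.add[OF Kc continuous_on_const] A.const[of t x] by simp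
    also have "t * A (\<lambda>y. 1) x \<le> t * c" using c(2)[of x] t(1) by (intro mult_left_mono) auto
    finally show "A h x - measure (operator_measure A x) ?E \<le> d"
      using Kd[OF x] t(2) by (simp add: m_def)
  qed
qed

end

section \<open>Entropy of partitions of unity\<close>

text \<open>
  A partition of unity is a set of functions, so equal members of an indexed family have to be
  merged; doubling a function keeps its support.
\<close>

lemma finite_set_add_function:
  fixes h :: "'a \<Rightarrow> real"
  assumes "finite G" "\<And>g. g \<in> G \<Longrightarrow> P g" "P h" and double: "\<And>g. P g \<Longrightarrow> P (\<lambda>x. 2 * g x)"
  shows "\<exists>G'. finite G' \<and> (\<forall>g\<in>G'. P g) \<and> (\<forall>x. (\<Sum>g\<in>G'. g x) = (\<Sum>g\<in>G. g x) + h x)"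
  using assms(1-3)
proof (induction "card G" arbitrary: G h)
  case 0
  then show ?case by (intro exI[of _ "{h}"]) simp
next
  case (Suc n)
  show ?case
  proof (cases "h \<in> G")
    case False
    with Suc.prems show ?thesis by (intro exI[of _ "insert h G"]) auto
  next
    case True
    \<comment> \<open>On a collision h leaves G and its double is to be added. The double may
      collide again, but G has become smaller, so the induction on the cardinality ends.\<close>
    have "\<exists>G'. finite G' \<and> (\<forall>g\<in>G'. P g) \<and> (\<forall>x. (\<Sum>g\<in>G'. g x) = (\<Sum>g\<in>G - {h}. g x) + 2 * h x)"
      using Suc.hyps(2) Suc.prems True double by (intro Suc.hyps(1)) auto
    moreover have "(\<Sum>g\<in>G. g x) = (\<Sum>g\<in>G - {h}. g x) + h x" for x
      using Suc.prems(1) True by (simp add: sum.remove)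
    ultimately show ?thesis by auto
  qed
qed

lemma finite_set_of_family:
  fixes g :: "'i \<Rightarrow> 'a \<Rightarrow> real"
  assumes "finite I" "\<And>i. i \<in> I \<Longrightarrow> P (g i)" and double: "\<And>g. P g \<Longrightarrow> P (\<lambda>x. 2 * g x)"
  shows "\<exists>G. finite G \<and> (\<forall>g\<in>G. P g) \<and> (\<forall>x. (\<Sum>g\<in>G. g x) = (\<Sum>i\<in>I. g i x))"
  using assms(1,2)
proof (induction rule: finite_induct)
  case empty
  show ?case by (intro exI[of _ "{}"]) simp
next
  case (insert i I)
  then obtain G where G: "finite G" "\<forall>g\<in>G. P g" "\<forall>x. (\<Sum>g\<in>G. g x) = (\<Sum>i\<in>I. g i x)" by auto
  show ?case
    using finite_set_add_function[of G P "g i"] G insert double by (auto simp: add.commute)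
qed

text \<open>Only the tents at m, the floor of s, and at m + 1 can be nonzero at s, and their heights
  add up to 1. The - 1 in the bound keeps m + 1 in the index range.\<close>

lemma sum_tents:
  fixes s :: real
  assumes "\<bar>s\<bar> \<le> of_int K - 1"
  shows "(\<Sum>k\<in>{-K..K}. max 0 (1 - \<bar>s - of_int k\<bar>)) = 1"
proof -
  define m where "m = \<lfloor>s\<rfloor>"
  have m: "of_int m \<le> s" "s < of_int m + 1" unfolding m_def by linarith+
  have "{m, m + 1} \<subseteq> {-K..K}" using assms m by auto
  moreover have "max 0 (1 - \<bar>s - of_int k\<bar>) = 0" if "k \<in> {-K..K} - {m, m + 1}" for k
  proof -
    from that have "k \<le> m - 1 \<or> m + 2 \<le> k" by auto
    then have "real_of_int k \<le> of_int m - 1 \<or> of_int m + 2 \<le> real_of_int k" by linarith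
    then show ?thesis using m by auto
  qed
  ultimately have "(\<Sum>k\<in>{-K..K}. max 0 (1 - \<bar>s - of_int k\<bar>)) = (\<Sum>k\<in>{m, m + 1}. max 0 (1 - \<bar>s - of_int k\<bar>))"
    by (intro sum.mono_neutral_right) auto
  also have "\<dots> = 1" using m by (simp add: max_def)
  finally show ?thesis .
qed

lemma fine_partition_of_unity:
  fixes \<psi> :: "'a::t2_space \<Rightarrow> real"
  assumes cpt: "compact (UNIV :: 'a set)" and \<psi>: "continuous_on UNIV \<psi>" and e: "0 < e"
  obtains G where "G \<in> partitions_of_unity"
    "\<And>g. g \<in> G \<Longrightarrow> \<exists>a. \<forall>x. g x \<noteq> 0 \<longrightarrow> a \<le> \<psi> x \<and> \<psi> x \<le> a + e"
proof -
  obtain c where c: "0 < c" "\<And>x. \<bar>\<psi> x\<bar> \<le> c" using bounded_continuous_compact[OF cpt \<psi>] by metis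
  define P where "P = (\<lambda>g :: 'a \<Rightarrow> real. continuous_on UNIV g \<and> (\<forall>x. 0 \<le> g x) \<and>
    (\<exists>a. \<forall>x. g x \<noteq> 0 \<longrightarrow> a \<le> \<psi> x \<and> \<psi> x \<le> a + e))"
  \<comment> \<open>Tents in the variable s have width 2, so the scale 2 / e gives them width e in
    \<psi>.\<close>
  define s where "s = (\<lambda>x. 2 * \<psi> x / e)"
  define K where "K = \<lceil>2 * c / e\<rceil> + 1"
  define g where "g = (\<lambda>(k::int) x. max 0 (1 - \<bar>s x - of_int k\<bar>))"
  have "P (g k)" for k
    unfolding P_def
  proof (intro conjI exI[of _ "e / 2 * (of_int k - 1)"] allI impI)
    show "continuous_on UNIV (g k)"
      unfolding g_def s_def using e by (intro continuous_intros \<psi>) auto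
    show "0 \<le> g k x" for x by (simp add: g_def)
    fix x assume "g k x \<noteq> 0"
    then have "of_int k - 1 \<le> s x" "s x \<le> of_int k + 1" by (auto simp: g_def max_def split: if_splits)
    then show "e / 2 * (of_int k - 1) \<le> \<psi> x" "\<psi> x \<le> e / 2 * (of_int k - 1) + e"
      using e by (auto simp: s_def field_simps)
  qed
  moreover have "P (\<lambda>x. 2 * f x)" if "P f" for f
    using that unfolding P_def by (auto intro!: continuous_intros)
  ultimately obtain G where G: "finite G" "\<forall>g\<in>G. P g" "\<forall>x. (\<Sum>g\<in>G. g x) = (\<Sum>k\<in>{-K..K}. g k x)"
    using finite_set_of_family[of "{-K..K}" P g] by auto
  have "(\<Sum>k\<in>{-K..K}. g k x) = 1" for x
    unfolding g_def
  proof (rule sum_tents)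
    have "\<bar>s x\<bar> \<le> 2 * c / e" using c(2)[of x] e by (simp add: s_def abs_mult divide_right_mono)
    then show "\<bar>s x\<bar> \<le> of_int K - 1" unfolding K_def by linarith
  qed
  with G have "G \<in> partitions_of_unity" by (auto simp: partitions_of_unity_def P_def)
  with G(2) that show thesis by (auto simp: P_def)
qed

section \<open>Entropy sums for an abstract positive functional\<close>

lemma eln_ereal: "eln (ereal t) = (if t \<le> 0 then -\<infinity> else ereal (ln t))"
  by (simp add: eln_def)

text \<open>With m f = mu[A^n f] this is the inner sum of the t-entropy; an abstract m separates the
  entropy estimates from the operator.\<close>

definition partition_entropy :: "(('a \<Rightarrow> real) \<Rightarrow> real) \<Rightarrow> 'a measure \<Rightarrow> ('a \<Rightarrow> real) set \<Rightarrow> ereal" where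
  "partition_entropy m \<mu> G = (\<Sum>g\<in>G. if integral\<^sup>L \<mu> g = 0 then 0
     else ereal (integral\<^sup>L \<mu> g) * eln (ereal (m g / integral\<^sup>L \<mu> g)))"

text \<open>ln t \<le> t - 1 at t = q / (p z). Being affine in q, the bound sums over a partition:
  when the p add up to 1 and the q to at most z, the total is at most ln z.\<close>

lemma ln_ratio_le:
  fixes p q z :: real
  assumes "0 < p" "0 < q" "0 < z"
  shows "p * ln (q / p) \<le> q / z - p + p * ln z"
proof -
  have "ln (q / (p * z)) \<le> q / (p * z) - 1"
    using assms by (intro ln_le_minus_one) simp
  then have "p * ln (q / (p * z)) \<le> p * (q / (p * z) - 1)"
    using assms by (intro mult_left_mono) auto
  moreover have "ln (q / (p * z)) = ln (q / p) - ln z"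
    using assms by (simp add: ln_div ln_mult)
  moreover have "p * (q / (p * z) - 1) = q / z - p"
    using assms by (simp add: field_simps)
  ultimately show ?thesis by (simp add: algebra_simps)
qed

text \<open>Where g is nonzero, \<psi> lies between a level a and a + e, so g \<le> exp(a + e)
  exp(-\<psi>) g and m g is at most exp(a + e) q with q = m(exp(-\<psi>) g). The terms p a add up to
  at most mu[\<psi>], and the remaining sum of p ln(q/p) is at most ln z by
  \<open>ln_ratio_le\<close>, because the q add up to at most z.\<close>

lemma partition_entropy_upper:
  fixes \<psi> :: "'a::t2_space \<Rightarrow> real"
  assumes cpt: "compact (UNIV :: 'a set)" and \<mu>: "regular_borel_measure \<mu>" "prob_space \<mu>"
    and m: "positive_functional m" and \<psi>: "continuous_on UNIV \<psi>"
    and z: "m (\<lambda>x. exp (- \<psi> x)) \<le> z" "0 < z" and e: "0 < e"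
  obtains G where "G \<in> partitions_of_unity"
    "partition_entropy m \<mu> G \<le> ereal (integral\<^sup>L \<mu> \<psi> + e + ln z)"
proof -
  interpret positive_functional m by (rule m)
  interpret prob_space \<mu> by (rule \<mu>(2))
  note int = integrable_continuous_compact[OF cpt \<mu>(1)]
  obtain G where G: "G \<in> partitions_of_unity"
    "\<And>g. g \<in> G \<Longrightarrow> \<exists>a. \<forall>x. g x \<noteq> 0 \<longrightarrow> a \<le> \<psi> x \<and> \<psi> x \<le> a + e"
    using fine_partition_of_unity[OF cpt \<psi> e] by metis
  then obtain a where a: "\<And>g x. g \<in> G \<Longrightarrow> g x \<noteq> 0 \<Longrightarrow> a g \<le> \<psi> x \<and> \<psi> x \<le> a g + e" by metis
  have fin: "finite G" and gc: "\<And>g. g \<in> G \<Longrightarrow> continuous_on UNIV g" and g0: "\<And>g x. g \<in> G \<Longrightarrow> 0 \<le> g x"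
    and g1: "\<And>x. (\<Sum>g\<in>G. g x) = 1"
    using G(1) by (auto simp: partitions_of_unity_def)
  define p :: "('a \<Rightarrow> real) \<Rightarrow> real" where "p = (\<lambda>g. integral\<^sup>L \<mu> g)"
  define q where "q = (\<lambda>g. m (\<lambda>x. exp (- \<psi> x) * g x))"
  have p0: "0 \<le> p g" if "g \<in> G" for g
    unfolding p_def using g0[OF that] by (simp add: integral_nonneg_AE)
  have ec: "continuous_on UNIV (\<lambda>x. exp (- \<psi> x) * g x)" if "g \<in> G" for g
    by (intro continuous_intros \<psi> gc that)
  have q0: "0 \<le> q g" if "g \<in> G" for g
    unfolding q_def using g0[OF that] by (intro nonneg ec that) auto
  have mq: "m g \<le> exp (a g + e) * q g" if g: "g \<in> G" for g
  proof -
    have "m g \<le> m (\<lambda>x. exp (a g + e) * (exp (- \<psi> x) * g x))"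
    proof (rule mono)
      fix x
      show "g x \<le> exp (a g + e) * (exp (- \<psi> x) * g x)"
      proof (cases "g x = 0")
        case False
        then have "1 \<le> exp (a g + e) * exp (- \<psi> x)" using a[OF g False] by (simp flip: exp_add)
        then show ?thesis using mult_right_mono[OF _ g0[OF g, of x]] by (fastforce simp: mult_ac)
      qed simp
    qed (intro continuous_intros gc g \<psi>)+
    then show ?thesis by (simp add: q_def scale[OF ec[OF g]])
  qed
  have sum_p: "(\<Sum>g\<in>G. p g) = 1"
    unfolding p_def using int gc g1 prob_space
    by (simp flip: Bochner_Integration.integral_sum)
  have sum_q: "(\<Sum>g\<in>G. q g) \<le> z"
  proof -
    have "(\<Sum>g\<in>G. q g) = m (\<lambda>x. \<Sum>g\<in>G. exp (- \<psi> x) * g x)"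
      unfolding q_def by (rule sum[symmetric, OF fin ec])
    also have "\<dots> = m (\<lambda>x. exp (- \<psi> x))" by (simp add: g1 flip: sum_distrib_left)
    finally show ?thesis using z by simp
  qed
  have sum_pa: "(\<Sum>g\<in>G. p g * a g) \<le> integral\<^sup>L \<mu> \<psi>"
  proof -
    have "(\<Sum>g\<in>G. p g * a g) = (\<Sum>g\<in>G. \<integral>x. g x * a g \<partial>\<mu>)" by (simp add: p_def)
    also have "\<dots> \<le> (\<Sum>g\<in>G. \<integral>x. g x * \<psi> x \<partial>\<mu>)"
    proof (intro sum_mono integral_mono)
      fix g x assume g: "g \<in> G"
      show "integrable \<mu> (\<lambda>x. g x * a g)" "integrable \<mu> (\<lambda>x. g x * \<psi> x)"
        by (intro int continuous_intros gc g \<psi>)+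
      show "g x * a g \<le> g x * \<psi> x"
        using a[OF g, of x] g0[OF g, of x] by (cases "g x = 0") (auto intro: mult_left_mono)
    qed
    also have "\<dots> = (\<integral>x. (\<Sum>g\<in>G. g x * \<psi> x) \<partial>\<mu>)"
      by (rule Bochner_Integration.integral_sum[symmetric]) (intro int continuous_intros gc \<psi>)
    also have "\<dots> = integral\<^sup>L \<mu> \<psi>" by (simp add: g1 flip: sum_distrib_right)
    finally show ?thesis .
  qed
  \<comment> \<open>A majorant whose total is explicit: \<open>sum_p\<close>, \<open>sum_q\<close>
    and \<open>sum_pa\<close> bound the sum of b by mu[\<psi>] + e + ln z.\<close>
  define b where "b = (\<lambda>g. p g * (a g + e) + q g / z - p g + p g * ln z)"
  have "partition_entropy m \<mu> G \<le> (\<Sum>g\<in>G. ereal (b g))"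
    unfolding partition_entropy_def
  proof (rule sum_mono)
    fix g assume g: "g \<in> G"
    show "(if integral\<^sup>L \<mu> g = 0 then 0 else ereal (integral\<^sup>L \<mu> g) * eln (ereal (m g / integral\<^sup>L \<mu> g)))
        \<le> ereal (b g)"
    proof (cases "p g = 0")
      case True
      then show ?thesis using q0[OF g] z by (simp add: b_def flip: p_def)
    next
      case False
      then have p: "0 < p g" using p0[OF g] by simp
      show ?thesis
      proof (cases "m g \<le> 0")
        case True
        then show ?thesis using p by (simp add: eln_ereal divide_nonpos_pos flip: p_def)
      next
        case False
        then have mg: "0 < m g" by simp
        with mq[OF g] have q: "0 < q g" by (metis exp_gt_zero less_le_trans mult_less_cancel_left_pos mult_zero_right)
        have "ln (m g / p g) \<le> ln (exp (a g + e) * q g / p g)"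
          using mg mq[OF g] p q by (subst ln_le_cancel_iff) (auto intro: divide_right_mono)
        also have "\<dots> = (a g + e) + ln (q g / p g)"
          using p q by (simp add: ln_mult ln_div)
        finally have "p g * ln (m g / p g) \<le> p g * ((a g + e) + ln (q g / p g))"
          using p by (intro mult_left_mono) auto
        also have "\<dots> \<le> b g"
          using ln_ratio_le[OF p q z(2)] by (simp add: b_def algebra_simps)
        finally show ?thesis using mg p by (simp add: eln_ereal not_le flip: p_def)
      qed
    qed
  qed
  also have "(\<Sum>g\<in>G. ereal (b g)) = ereal (\<Sum>g\<in>G. b g)" by simp
  also have "(\<Sum>g\<in>G. b g) = (\<Sum>g\<in>G. p g * a g) + e + (\<Sum>g\<in>G. q g) / z - 1 + ln z"
    using sum_p by (simp add: b_def sum.distrib sum_subtractf algebra_simps sum_divide_distrib flip: sum_distrib_left)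
  also have "\<dots> \<le> integral\<^sup>L \<mu> \<psi> + e + ln z"
    using sum_pa sum_q z(2) divide_le_eq_1_pos[of z "\<Sum>g\<in>G. q g"] by linarith
  finally have "partition_entropy m \<mu> G \<le> ereal (integral\<^sup>L \<mu> \<psi> + e + ln z)" by simp
  with G(1) that show thesis by blast
qed

text \<open>Jensen's inequality for ln with respect to g mu, separately for each member g; the
  members add up to 1, so the left sides add up to the integral of ln r. The function r will be the
  product of the cocycle along n orbit points.\<close>

lemma partition_entropy_lower:
  fixes r :: "'a::t2_space \<Rightarrow> real"
  assumes cpt: "compact (UNIV :: 'a set)" and \<mu>: "regular_borel_measure \<mu>" "prob_space \<mu>"
    and G: "G \<in> partitions_of_unity"
    and r: "AE x in \<mu>. 0 < r x" "integrable \<mu> r" "integrable \<mu> (\<lambda>x. ln (r x))"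
    and m: "\<And>g. g \<in> G \<Longrightarrow> (\<integral>x. r x * g x \<partial>\<mu>) \<le> m g"
  shows "ereal (\<integral>x. ln (r x) \<partial>\<mu>) \<le> partition_entropy m \<mu> G"
proof -
  interpret prob_space \<mu> by (rule \<mu>(2))
  note int = integrable_continuous_compact[OF cpt \<mu>(1)]
  have fin: "finite G" and gc: "\<And>g. g \<in> G \<Longrightarrow> continuous_on UNIV g" and g0: "\<And>g x. g \<in> G \<Longrightarrow> 0 \<le> g x"
    and g1: "\<And>x. (\<Sum>g\<in>G. g x) = 1"
    using G(1) by (auto simp: partitions_of_unity_def)
  have mult: "integrable \<mu> (\<lambda>x. f x * g x)" if g: "g \<in> G" and f: "integrable \<mu> f" for f :: "'a \<Rightarrow> real" and g
  proof -
    obtain c where c: "\<And>x. \<bar>g x\<bar> \<le> c" using bounded_continuous_compact[OF cpt gc[OF g]] by metis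
    show ?thesis
    proof (rule Bochner_Integration.integrable_bound)
      show "integrable \<mu> (\<lambda>x. c * f x)" using f by simp
      show "(\<lambda>x. f x * g x) \<in> borel_measurable \<mu>"
        using f int[OF gc[OF g]] by (intro borel_measurable_times) auto
      show "AE x in \<mu>. norm (f x * g x) \<le> norm (c * f x)"
      proof (rule AE_I2)
        fix x
        have "\<bar>g x\<bar> \<le> \<bar>c\<bar>" using c[of x] by simp
        from mult_right_mono[OF this, of "\<bar>f x\<bar>"] show "norm (f x * g x) \<le> norm (c * f x)"
          by (simp add: abs_mult mult.commute)
      qed
    qed
  qed
  have piece: "ereal (\<integral>x. ln (r x) * g x \<partial>\<mu>) \<le>
      (if integral\<^sup>L \<mu> g = 0 then 0 else ereal (integral\<^sup>L \<mu> g) * eln (ereal (m g / integral\<^sup>L \<mu> g)))"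
    if g: "g \<in> G" for g
  proof (cases "integral\<^sup>L \<mu> g = 0")
    case True
    then have "AE x in \<mu>. g x = 0"
      using integral_nonneg_eq_0_iff_AE[OF int[OF gc[OF g]]] g0[OF g] by simp
    then have "(\<integral>x. ln (r x) * g x \<partial>\<mu>) = 0" by (intro integral_eq_zero_AE) auto
    with True show ?thesis by simp
  next
    case False
    define p where "p = integral\<^sup>L \<mu> g"
    have p: "0 < p" using False g0[OF g] by (simp add: p_def less_le integral_nonneg_AE)
    \<comment> \<open>Otherwise \<open>eln\<close> would give -\<infinity>. Positivity of r almost
      everywhere excludes this because p > 0.\<close>
    have "m g > 0"
    proof (rule ccontr)
      assume "\<not> m g > 0"
      have rg: "AE x in \<mu>. 0 \<le> r x * g x" using r(1) by eventually_elim (simp add: g0[OF g])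
      with m[OF g] \<open>\<not> m g > 0\<close> have "(\<integral>x. r x * g x \<partial>\<mu>) = 0"
        using integral_nonneg_AE[OF rg] by linarith
      then have "AE x in \<mu>. r x * g x = 0"
        using integral_nonneg_eq_0_iff_AE[OF mult[OF g r(2)] rg] by simp
      with r(1) have "AE x in \<mu>. g x = 0" by eventually_elim auto
      then have "p = 0" unfolding p_def by (intro integral_eq_zero_AE)
      with p show False by simp
    qed
    \<comment> \<open>The tangent to ln is taken at c = m g / p, the point for which the linear
      terms cancel and p ln c remains.\<close>
    define c where "c = m g / p"
    have c: "0 < c" using \<open>m g > 0\<close> p by (simp add: c_def)
    have "(\<integral>x. ln (r x) * g x \<partial>\<mu>) \<le> (\<integral>x. 1 / c * (r x * g x) + (ln c - 1) * g x \<partial>\<mu>)"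
    proof (rule integral_mono_AE)
      show "AE x in \<mu>. ln (r x) * g x \<le> 1 / c * (r x * g x) + (ln c - 1) * g x"
        using r(1)
      proof eventually_elim
        case (elim x)
        have "ln (r x / c) \<le> r x / c - 1" using elim c by (intro ln_le_minus_one) simp
        then have "ln (r x) \<le> r x / c + (ln c - 1)" using elim c by (simp add: ln_div)
        from mult_right_mono[OF this g0[OF g, of x]] show ?case by (simp add: algebra_simps)
      qed
    qed (intro Bochner_Integration.integrable_add integrable_mult_right mult[OF g] r int gc g)+
    also have "\<dots> = 1 / c * (\<integral>x. r x * g x \<partial>\<mu>) + (ln c - 1) * p"
      unfolding p_def using mult[OF g r(2)] int[OF gc[OF g]] by simp
    also have "\<dots> \<le> 1 / c * m g + (ln c - 1) * p"
      using c m[OF g] by (intro add_right_mono mult_left_mono) auto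
    also have "\<dots> = p * ln (m g / p)"
      using p \<open>m g > 0\<close> by (simp add: c_def algebra_simps)
    finally show ?thesis using False p \<open>m g > 0\<close> by (simp add: eln_ereal not_le flip: p_def)
  qed
  have "(\<integral>x. ln (r x) \<partial>\<mu>) = (\<integral>x. (\<Sum>g\<in>G. ln (r x) * g x) \<partial>\<mu>)"
    by (simp add: g1 flip: sum_distrib_left)
  also have "\<dots> = (\<Sum>g\<in>G. \<integral>x. ln (r x) * g x \<partial>\<mu>)"
    by (intro Bochner_Integration.integral_sum mult r(3))
  finally have "ereal (\<integral>x. ln (r x) \<partial>\<mu>) = (\<Sum>g\<in>G. ereal (\<integral>x. ln (r x) * g x \<partial>\<mu>))" by simp
  also have "\<dots> \<le> partition_entropy m \<mu> G"
    unfolding partition_entropy_def by (intro sum_mono piece)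
  finally show ?thesis .
qed

section \<open>Integrals of logarithms with values in the extended reals\<close>

lemma extended_set_integral_full:
  assumes "\<And>x. x \<notin> S \<Longrightarrow> f x = 0"
  shows "extended_set_integral M S f =
    enn2ereal (\<integral>\<^sup>+x. e2ennreal (f x) \<partial>M) - enn2ereal (\<integral>\<^sup>+x. e2ennreal (- f x) \<partial>M)"
proof -
  have "e2ennreal (f x) * indicator S x = e2ennreal (f x)"
    "e2ennreal (- f x) * indicator S x = e2ennreal (- f x)" for x
  proof -
    have "e2ennreal 0 = 0" by (simp add: zero_ennreal_def)
    then show "e2ennreal (f x) * indicator S x = e2ennreal (f x)"
      "e2ennreal (- f x) * indicator S x = e2ennreal (- f x)"
      using assms[of x] by (cases "x \<in> S"; force)+
  qed
  then show ?thesis unfolding extended_set_integral_def by (simp only:)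
qed

lemma e2ennreal_eln:
  "e2ennreal (eln (ereal t)) = (if t \<le> 0 then 0 else ennreal (ln t))"
  "e2ennreal (- eln (ereal t)) = (if t \<le> 0 then \<infinity> else ennreal (- ln t))"
  by (auto simp: eln_ereal e2ennreal_neg)

definition log_integral :: "'a measure \<Rightarrow> ('a \<Rightarrow> real) \<Rightarrow> ereal" where
  "log_integral M r = extended_set_integral M UNIV (\<lambda>x. eln (ereal (r x)))"

context
  fixes \<mu> :: "'a measure" and r :: "'a \<Rightarrow> real" and c :: real
  assumes \<mu>: "prob_space \<mu>" and r [measurable]: "r \<in> borel_measurable \<mu>" and r_le: "\<And>x. r x \<le> c"
begin

lemma log_positive_part_finite: "(\<integral>\<^sup>+x. e2ennreal (eln (ereal (r x))) \<partial>\<mu>) < \<infinity>"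
proof -
  interpret prob_space \<mu> by (rule \<mu>)
  have "(\<integral>\<^sup>+x. e2ennreal (eln (ereal (r x))) \<partial>\<mu>) \<le> (\<integral>\<^sup>+x. ennreal \<bar>ln c\<bar> \<partial>\<mu>)"
  proof (rule nn_integral_mono)
    fix x
    show "e2ennreal (eln (ereal (r x))) \<le> ennreal \<bar>ln c\<bar>"
    proof (cases "0 < r x")
      case True
      then have "ln (r x) \<le> ln c" using r_le[of x] by simp
      then show ?thesis using True by (auto simp: e2ennreal_eln intro!: ennreal_leI)
    qed (simp add: e2ennreal_eln)
  qed
  also have "\<dots> < \<infinity>" by (simp add: emeasure_space_1)
  finally show ?thesis .
qed

text \<open>Since r is bounded above, the positive part of the logarithm has finite integral; a
  value other than -\<infinity> then forces a finite negative part, so r > 0 almost everywhere and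
  \<open>eln\<close> agrees with ln there.\<close>

lemma log_integral_eq:
  assumes "log_integral \<mu> r \<noteq> -\<infinity>"
  shows "AE x in \<mu>. 0 < r x" "integrable \<mu> (\<lambda>x. ln (r x))" "log_integral \<mu> r = ereal (\<integral>x. ln (r x) \<partial>\<mu>)"
proof -
  define p q where "p = (\<integral>\<^sup>+x. e2ennreal (eln (ereal (r x))) \<partial>\<mu>)"
    and "q = (\<integral>\<^sup>+x. e2ennreal (- eln (ereal (r x))) \<partial>\<mu>)"
  have I: "log_integral \<mu> r = enn2ereal p - enn2ereal q"
    unfolding log_integral_def p_def q_def by (rule extended_set_integral_full) simp
  have p: "p < \<infinity>" unfolding p_def by (rule log_positive_part_finite)
  have q: "q \<noteq> \<infinity>" using assms p unfolding I by (cases p; cases q) auto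
  have "AE x in \<mu>. e2ennreal (- eln (ereal (r x))) \<noteq> \<infinity>"
    using q unfolding q_def by (intro nn_integral_PInf_AE) (auto simp: e2ennreal_eln)
  then show pos: "AE x in \<mu>. 0 < r x"
    by eventually_elim (auto simp: e2ennreal_eln split: if_splits)
  have p_eq: "p = (\<integral>\<^sup>+x. ennreal (ln (r x)) \<partial>\<mu>)" and q_eq: "q = (\<integral>\<^sup>+x. ennreal (- ln (r x)) \<partial>\<mu>)"
    unfolding p_def q_def using pos by (auto intro!: nn_integral_cong_AE elim!: eventually_mono simp: e2ennreal_eln)
  show int: "integrable \<mu> (\<lambda>x. ln (r x))"
    using p q by (simp add: real_integrable_def p_eq q_eq)
  show "log_integral \<mu> r = ereal (\<integral>x. ln (r x) \<partial>\<mu>)"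
    unfolding I real_lebesgue_integral_def[OF int] using p q
    by (cases p; cases q) (simp_all flip: p_eq q_eq)
qed

text \<open>Monotone convergence for the truncations max(r, 1/(k+1)). As the threshold is at most 1,
  the positive part of the logarithm never changes, while the negative parts increase to that of ln
  r, with limit \<infinity> where r \<le> 0. A strict bound is therefore reached at a finite
  k.\<close>

lemma log_integral_less:
  assumes "log_integral \<mu> r < ereal b"
  obtains e where "0 < e" "(\<integral>x. ln (max (r x) e) \<partial>\<mu>) < b"
proof -
  interpret prob_space \<mu> by (rule \<mu>)
  define p q where "p = (\<integral>\<^sup>+x. e2ennreal (eln (ereal (r x))) \<partial>\<mu>)"
    and "q = (\<integral>\<^sup>+x. e2ennreal (- eln (ereal (r x))) \<partial>\<mu>)"
  have I: "log_integral \<mu> r = enn2ereal p - enn2ereal q"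
    unfolding log_integral_def p_def q_def by (rule extended_set_integral_full) simp
  have p: "p < \<infinity>" unfolding p_def by (rule log_positive_part_finite)
  define f where "f = (\<lambda>(k::nat) x. ln (max (r x) (1 / real (Suc k))))"
  have f_meas [measurable]: "f k \<in> borel_measurable \<mu>" for k unfolding f_def by measurable
  have f_lower: "- ln (real (Suc k)) \<le> f k x" for k x
  proof -
    have "ln (1 / real (Suc k)) \<le> f k x" unfolding f_def by (intro ln_mono) auto
    then show ?thesis by (simp add: ln_div)
  qed
  have f_int: "integrable \<mu> (f k)" for k
  proof (rule integrable_const_bound[OF AE_I2])
    fix x
    have "1 / real (Suc k) \<le> 1" by simp
    then have "max (r x) (1 / real (Suc k)) \<le> max c 1" using r_le[of x] by linarith
    moreover have "0 < max (r x) (1 / real (Suc k))" by (simp add: less_max_iff_disj)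
    ultimately have "f k x \<le> ln (max c 1)" unfolding f_def by (intro ln_mono)
    then show "norm (f k x) \<le> ln (max c 1) + ln (real (Suc k))"
      using f_lower[of k x] ln_ge_zero[of "max c 1", OF max.cobounded2]
        ln_ge_zero[of "real (Suc k)"] unfolding real_norm_def by linarith
  qed simp
  have pos_part: "ennreal (f k x) = e2ennreal (eln (ereal (r x)))" for k x
  proof (cases "r x \<le> 1 / real (Suc k)")
    case True
    then have "f k x \<le> 0" by (simp add: f_def max_def ln_div)
    moreover have "ln (r x) \<le> 0" if "0 < r x"
      using True that by (intro ln_le_zero_iff[THEN iffD2]) (auto intro: order_trans)
    ultimately show ?thesis by (auto simp: e2ennreal_eln ennreal_neg)
  next
    case False
    moreover have "0 < 1 / real (Suc k)" by simp
    ultimately have "0 < r x" by linarith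
    with False show ?thesis by (simp add: f_def e2ennreal_eln max_def)
  qed
  have neg_part: "(SUP k. ennreal (- f k x)) = e2ennreal (- eln (ereal (r x)))" for x
  proof (cases "0 < r x")
    case True
    obtain k where k: "1 / real (Suc k) < r x" using True nat_approx_posE by blast
    have "ennreal (- f j x) \<le> ennreal (- ln (r x))" for j
      unfolding f_def using True by (intro ennreal_leI) (simp add: ln_mono)
    moreover have "f k x = ln (r x)" using k by (simp add: f_def max_def)
    ultimately have "(SUP k. ennreal (- f k x)) = ennreal (- ln (r x))"
      by (intro antisym SUP_least SUP_upper2[of k]) auto
    then show ?thesis using True by (simp add: e2ennreal_eln)
  next
    case False
    have f: "f k x = - ln (real (Suc k))" for k
      using False by (auto simp: f_def max_def ln_div not_less intro: order_trans)
    have "(SUP k. ennreal (- f k x)) = top"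
    proof (rule ennreal_SUP_eq_top)
      fix n :: nat
      obtain k :: nat where "exp (real n) < real k" using reals_Archimedean2 by blast
      then have "real n \<le> ln (real (Suc k))"
        by (subst ln_ge_iff) auto
      then have "ennreal (real n) \<le> ennreal (- f k x)" unfolding f by (intro ennreal_leI) simp
      then show "\<exists>i\<in>UNIV. of_nat n \<le> ennreal (- f i x)" by (auto simp: ennreal_of_nat_eq_real_of_nat)
    qed
    then show ?thesis using False by (simp add: e2ennreal_eln)
  qed
  define s where "s = (\<lambda>k. \<integral>\<^sup>+x. ennreal (- f k x) \<partial>\<mu>)"
  have "q = (\<integral>\<^sup>+x. (SUP k. ennreal (- f k x)) \<partial>\<mu>)" by (simp add: q_def neg_part)
  also have "\<dots> = (SUP k. s k)"
    unfolding s_def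
  proof (rule nn_integral_monotone_convergence_SUP)
    show "incseq (\<lambda>k x. ennreal (- f k x))"
    proof (rule incseq_SucI, rule le_funI)
      fix k x
      have "f (Suc k) x \<le> f k x"
        unfolding f_def by (intro ln_mono max.mono order_refl divide_left_mono) (auto simp: less_max_iff_disj)
      then show "ennreal (- f k x) \<le> ennreal (- f (Suc k) x)" by (intro ennreal_leI) simp
    qed
  qed measurable
  finally have q: "q = (SUP k. s k)" .
  have s_fin: "s k < \<infinity>" for k
    using f_int[of k] by (simp add: s_def real_integrable_def less_top)
  have f_eq: "(\<integral>x. f k x \<partial>\<mu>) = enn2real p - enn2real (s k)" for k
    unfolding real_lebesgue_integral_def[OF f_int] s_def p_def pos_part ..
  \<comment> \<open>\<open>ennreal\<close> sends negative reals to 0, so the strict comparison with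
    q is guaranteed only for a nonnegative left side; in the negative case any k will do.\<close>
  have "ennreal (enn2real p - b) < q \<or> enn2real p - b < 0"
  proof (cases q)
    case (real q')
    then show ?thesis using assms p unfolding I by (cases p) (auto simp: ennreal_less_iff)
  qed (simp add: ennreal_less_top)
  then have "\<exists>k. enn2real p - b < enn2real (s k)"
  proof
    assume "ennreal (enn2real p - b) < q"
    then obtain k where "ennreal (enn2real p - b) < s k" unfolding q less_SUP_iff by auto
    moreover obtain t where "s k = ennreal t" "0 \<le> t" using s_fin[of k] by (cases "s k") auto
    ultimately have "enn2real p - b < enn2real (s k)" by (metis enn2real_ennreal ennreal_leI not_le)
    then show ?thesis ..
  next
    assume "enn2real p - b < 0"
    then have "enn2real p - b < enn2real (s 0)" using enn2real_nonneg[of "s 0"] by linarith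
    then show ?thesis ..
  qed
  then obtain k where "enn2real p - b < enn2real (s k)" by blast
  then have "(\<integral>x. f k x \<partial>\<mu>) < b" unfolding f_eq by linarith
  then show thesis by (intro that[of "1 / real (Suc k)"]) (auto simp: f_def)
qed

end

section \<open>The t-entropy\<close>

lemma finite_sheeted_bound:
  assumes "finite_sheeted_on_essential \<alpha>"
  obtains N :: real where "\<And>x. x \<in> essential_points \<alpha> \<Longrightarrow> finite (essential_preimage \<alpha> 1 x)"
    "\<And>x. x \<in> essential_points \<alpha> \<Longrightarrow> real (card (essential_preimage \<alpha> 1 x)) \<le> N" "0 \<le> N"
proof -
  let ?f = "\<lambda>x. if finite (essential_preimage \<alpha> 1 x)
        then ereal (real (card (essential_preimage \<alpha> 1 x))) else \<infinity>"
  obtain n :: nat where "(SUP x\<in>essential_points \<alpha>. ?f x) < ereal (real n)"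
    using assms less_PInf_Ex_of_nat[of "SUP x\<in>essential_points \<alpha>. ?f x"]
    unfolding finite_sheeted_on_essential_def by auto
  then have "?f x < ereal (real n)" if "x \<in> essential_points \<alpha>" for x
    using SUP_upper[OF that, of ?f] by (rule order_le_less_trans[rotated])
  then have "finite (essential_preimage \<alpha> 1 x) \<and> real (card (essential_preimage \<alpha> 1 x)) \<le> real n"
    if "x \<in> essential_points \<alpha>" for x
    using that by (fastforce split: if_splits)
  with that[of "real n"] show thesis by auto
qed

lemma inverse_rami_rate_zero_bound:
  assumes "inverse_rami_rate \<alpha> = 0" "0 < e"
  shows "\<forall>\<^sub>F n in sequentially. \<forall>x\<in>essential_points \<alpha>.
    real (card (essential_preimage \<alpha> n x)) \<le> (1 + e) ^ n"
proof -
  let ?f = "\<lambda>n x. if finite (essential_preimage \<alpha> n x)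
        then ereal (root n (real (card (essential_preimage \<alpha> n x)))) else \<infinity>"
  \<comment> \<open>\<open>eln\<close> takes the value 0 only at 1.\<close>
  have "limsup (\<lambda>n. SUP x\<in>essential_points \<alpha>. ?f n x) = 1"
    using assms(1) unfolding inverse_rami_rate_def eln_def
    by (cases "limsup (\<lambda>n. SUP x\<in>essential_points \<alpha>. ?f n x)")
      (auto split: if_splits simp: ln_eq_zero_iff zero_ereal_def one_ereal_def)
  then have "limsup (\<lambda>n. SUP x\<in>essential_points \<alpha>. ?f n x) < ereal (1 + e)"
    using assms(2) by (simp add: one_ereal_def)
  from eventually_conj[OF Limsup_lessD[OF this] eventually_gt_at_top[of 0]]
  show ?thesis
  proof (rule eventually_mono, safe)
    fix n :: nat and x
    assume n: "0 < n" and x: "x \<in> essential_points \<alpha>"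
      and less: "(SUP x\<in>essential_points \<alpha>. ?f n x) < ereal (1 + e)"
    have "?f n x < ereal (1 + e)"
      using SUP_upper[OF x, of "?f n"] less by (rule order_le_less_trans)
    then have "root n (real (card (essential_preimage \<alpha> n x))) \<le> 1 + e"
      by (auto split: if_splits)
    then have "root n (real (card (essential_preimage \<alpha> n x))) ^ n \<le> (1 + e) ^ n"
      by (intro power_mono real_root_ge_zero) auto
    then show "real (card (essential_preimage \<alpha> n x)) \<le> (1 + e) ^ n"
      using n by simp
  qed
qed

lemma t_entropy_eq:
  "t_entropy A \<mu> = (INF n\<in>{1::nat..}. ereal (1 / real n) *
    (INF G\<in>partitions_of_unity. partition_entropy (\<lambda>f. integral\<^sup>L \<mu> ((A ^^ n) f)) \<mu> G))"
  by (simp add: t_entropy_def partition_entropy_def)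

section \<open>The two inequalities between entropy and the integral of the logarithm\<close>

context compact_transfer_operator
begin

text \<open>The value 1 makes the logarithm vanish off the essential set, so the integral over that
  set becomes one over the whole space, and continuity on a closed set yields Borel measurability
  everywhere.\<close>

definition extended_cocycle :: "'a \<Rightarrow> real" where
  "extended_cocycle x = (if x \<in> essential_points \<alpha> then cocycle \<alpha> A x else 1)"

lemma extended_cocycle_measurable:
  assumes "continuous_on (essential_points \<alpha>) (cocycle \<alpha> A)"
  shows "extended_cocycle \<in> borel_measurable borel"
  unfolding extended_cocycle_def[abs_def]
  using assms
  by (intro borel_measurable_continuous_on_if borel_closed closed_essential_points) auto

text \<open>rho(y) is at most the total mass of the measure attached to \<open>\<alpha> y\<close>,
  which is A 1 at that point; c \<ge> 1 accounts for the value off the essential set.\<close>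

lemma extended_cocycle_bounded:
  obtains c where "1 \<le> c" "\<And>x. A (\<lambda>x. 1) x \<le> c" "\<And>x. 0 \<le> extended_cocycle x" "\<And>x. extended_cocycle x \<le> c"
proof -
  obtain c where c: "0 < c" "\<And>x. \<bar>A (\<lambda>x. 1) x\<bar> \<le> c"
    using bounded_continuous_compact[OF compact_UNIV continuous_A[OF continuous_on_const]] by metis
  have "cocycle \<alpha> A x \<le> max c 1" for x
    using cocycle_mult_le[of "\<lambda>x. 1" x] c(2)[of "\<alpha> x"] by simp
  then have "extended_cocycle x \<le> max c 1" "0 \<le> extended_cocycle x" for x
    using cocycle_nonneg by (auto simp: extended_cocycle_def)
  moreover have "A (\<lambda>x. 1) x \<le> max c 1" for x using c(2)[of x] by simp
  ultimately show thesis using that[of "max c 1"] by auto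
qed

lemma extended_set_integral_cocycle:
  "extended_set_integral \<mu> (essential_points \<alpha>) (\<lambda>x. eln (ereal (cocycle \<alpha> A x)))
    = log_integral \<mu> extended_cocycle"
proof -
  have "(\<lambda>x. e2ennreal (eln (ereal (cocycle \<alpha> A x))) * indicator (essential_points \<alpha>) x)
      = (\<lambda>x. e2ennreal (eln (ereal (extended_cocycle x))) * indicator UNIV x)"
    "(\<lambda>x. e2ennreal (- eln (ereal (cocycle \<alpha> A x))) * indicator (essential_points \<alpha>) x)
      = (\<lambda>x. e2ennreal (- eln (ereal (extended_cocycle x))) * indicator UNIV x)"
    by (auto simp: fun_eq_iff extended_cocycle_def e2ennreal_eln indicator_def)
  then show ?thesis unfolding log_integral_def extended_set_integral_def by (simp only:)
qed

text \<open>Only a value other than -\<infinity> needs an argument: then rho > 0 almost everywhere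
  and ln rho is integrable, so \<open>partition_entropy_lower\<close> applies to the product R of
  rho along the first n orbit points. Invariance turns mu[ln R] into n J, and
  mu[(A^n g) o \<alpha>^n] into mu[A^n g].\<close>

lemma t_entropy_ge:
  assumes \<mu>: "\<mu> \<in> invariant_measures \<alpha>" and cont: "continuous_on (essential_points \<alpha>) (cocycle \<alpha> A)"
  shows "log_integral \<mu> extended_cocycle \<le> t_entropy A \<mu>"
proof (cases "log_integral \<mu> extended_cocycle = -\<infinity>")
  case False
  note inv = invariant_measuresD[OF \<mu>]
  interpret prob_space \<mu> by (rule inv)
  define r where "r = extended_cocycle"
  note meas = extended_cocycle_measurable[OF cont, folded r_def]
  have meas\<mu>: "r \<in> borel_measurable \<mu>"
    using meas regular_borel_measureD(1)[OF inv(1)] measurable_cong_sets by blast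
  obtain c where c: "1 \<le> c" "\<And>x. 0 \<le> r x" "\<And>x. r x \<le> c"
    using extended_cocycle_bounded unfolding r_def by metis
  note log = log_integral_eq[OF inv(2) meas\<mu> c(3) False[folded r_def]]
  define J where "J = (\<integral>x. ln (r x) \<partial>\<mu>)"
  have ln_meas: "(\<lambda>x. ln (r x)) \<in> borel_measurable borel" using meas by simp
  have "ereal J \<le> ereal (1 / real n) *
      (INF G\<in>partitions_of_unity. partition_entropy (\<lambda>f. integral\<^sup>L \<mu> ((A ^^ n) f)) \<mu> G)"
    if n: "1 \<le> n" for n
  proof -
    define R where "R = (\<lambda>x. \<Prod>i<n. r ((\<alpha> ^^ i) x))"
    have "AE x in \<mu>. \<forall>i. 0 < r ((\<alpha> ^^ i) x)"
      unfolding AE_all_countable by (intro allI invariant_funpow(3)[OF \<mu> continuous_\<alpha> log(1)])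
    then have R: "AE x in \<mu>. 0 < R x" "AE x in \<mu>. ln (R x) = (\<Sum>i<n. ln (r ((\<alpha> ^^ i) x)))"
      unfolding R_def by (eventually_elim, auto intro!: prod_pos ln_prod simp: less_imp_neq[symmetric])+
    have iter_meas: "(\<lambda>x. r ((\<alpha> ^^ i) x)) \<in> borel_measurable \<mu>" for i
      using measurable_compose[OF measurable_continuous_regular[OF inv(1) funpow_continuous[OF continuous_\<alpha>]] meas] .
    have R_meas: "R \<in> borel_measurable \<mu>"
      unfolding R_def by (intro borel_measurable_prod iter_meas)
    have R_le: "0 \<le> R x" "R x \<le> c ^ n" for x
    proof -
      show "0 \<le> R x" unfolding R_def by (intro prod_nonneg c ballI)
      have "R x \<le> (\<Prod>i<n. c)" unfolding R_def by (intro prod_mono conjI c)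
      then show "R x \<le> c ^ n" by simp
    qed
    have R_int: "integrable \<mu> R"
      using R_le by (intro integrable_const_bound[of _ "c ^ n"] R_meas) auto
    have sum_int: "integrable \<mu> (\<lambda>x. \<Sum>i<n. ln (r ((\<alpha> ^^ i) x)))"
      by (intro Bochner_Integration.integrable_sum invariant_funpow(2)[OF \<mu> continuous_\<alpha> ln_meas log(2)])
    have lnR_meas: "(\<lambda>x. ln (R x)) \<in> borel_measurable \<mu>" using R_meas by simp
    have lnR_int: "integrable \<mu> (\<lambda>x. ln (R x))"
      using sum_int R(2) by (subst integrable_cong_AE[OF lnR_meas borel_measurable_integrable[OF sum_int]]) auto
    have "(\<integral>x. ln (R x) \<partial>\<mu>) = (\<integral>x. (\<Sum>i<n. ln (r ((\<alpha> ^^ i) x))) \<partial>\<mu>)"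
      by (rule integral_cong_AE[OF lnR_meas borel_measurable_integrable[OF sum_int] R(2)])
    also have "\<dots> = (\<Sum>i<n. \<integral>x. ln (r ((\<alpha> ^^ i) x)) \<partial>\<mu>)"
      by (intro Bochner_Integration.integral_sum invariant_funpow(2)[OF \<mu> continuous_\<alpha> ln_meas log(2)])
    also have "\<dots> = (\<Sum>i<n. J)"
      unfolding J_def invariant_funpow(1)[OF \<mu> continuous_\<alpha> ln_meas] ..
    finally have lnR: "(\<integral>x. ln (R x) \<partial>\<mu>) = real n * J" by simp
    have "ereal (\<integral>x. ln (R x) \<partial>\<mu>) \<le> partition_entropy (\<lambda>f. integral\<^sup>L \<mu> ((A ^^ n) f)) \<mu> G"
      if G: "G \<in> partitions_of_unity" for G
    proof (rule partition_entropy_lower[OF compact_UNIV inv(1,2) G R(1) R_int lnR_int])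
      fix g assume "g \<in> G"
      then have g: "continuous_on UNIV g" "\<And>x. 0 \<le> g x" using G by (auto simp: partitions_of_unity_def)
      note Ag = iterate_continuous[OF g(1), of n]
      have Ag_int: "integrable \<mu> (\<lambda>x. (A ^^ n) g ((\<alpha> ^^ n) x))"
        by (rule invariant_funpow(2)[OF \<mu> continuous_\<alpha> borel_measurable_continuous_onI[OF Ag]
          integrable_continuous_compact[OF compact_UNIV inv(1) Ag]])
      have "(\<integral>x. R x * g x \<partial>\<mu>) \<le> (\<integral>x. (A ^^ n) g ((\<alpha> ^^ n) x) \<partial>\<mu>)"
      proof (rule integral_mono_AE)
        show le: "AE x in \<mu>. R x * g x \<le> (A ^^ n) g ((\<alpha> ^^ n) x)"
          using AE_essential_points[OF \<mu>]
        proof eventually_elim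
          case (elim x)
          then have "R x = (\<Prod>i<n. cocycle \<alpha> A ((\<alpha> ^^ i) x))"
            by (simp add: R_def r_def extended_cocycle_def essential_points_funpow[OF continuous_\<alpha>])
          then show ?case using prod_cocycle_mult_le[OF g, of x n] by simp
        qed
        show "integrable \<mu> (\<lambda>x. R x * g x)"
        proof (rule Bochner_Integration.integrable_bound[OF Ag_int])
          show "(\<lambda>x. R x * g x) \<in> borel_measurable \<mu>"
            by (intro borel_measurable_times R_meas measurable_continuous_regular[OF inv(1) g(1)])
          show "AE x in \<mu>. norm (R x * g x) \<le> norm ((A ^^ n) g ((\<alpha> ^^ n) x))"
            using le by eventually_elim (use g(2) R_le in simp)
        qed
      qed (rule Ag_int)
      also have "\<dots> = integral\<^sup>L \<mu> ((A ^^ n) g)"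
        by (rule invariant_funpow(1)[OF \<mu> continuous_\<alpha> borel_measurable_continuous_onI[OF Ag]])
      finally show "(\<integral>x. R x * g x \<partial>\<mu>) \<le> integral\<^sup>L \<mu> ((A ^^ n) g)" .
    qed
    then have "ereal (real n * J) \<le> (INF G\<in>partitions_of_unity. partition_entropy (\<lambda>f. integral\<^sup>L \<mu> ((A ^^ n) f)) \<mu> G)"
      unfolding lnR by (intro INF_greatest)
    then have "ereal (1 / real n) * ereal (real n * J) \<le> ereal (1 / real n) *
        (INF G\<in>partitions_of_unity. partition_entropy (\<lambda>f. integral\<^sup>L \<mu> ((A ^^ n) f)) \<mu> G)"
      by (intro ereal_mult_left_mono) auto
    then show ?thesis using n by simp
  qed
  then show ?thesis
    unfolding t_entropy_eq log(3)[unfolded r_def] by (intro INF_greatest) (simp add: J_def r_def)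
qed simp

lemma tietze_essential:
  fixes f :: "'a \<Rightarrow> real"
  assumes "continuous_on (essential_points \<alpha>) f" "\<And>x. x \<in> essential_points \<alpha> \<Longrightarrow> a \<le> f x \<and> f x \<le> b" "a \<le> b"
  obtains g where "continuous_on UNIV g" "\<And>x. x \<in> essential_points \<alpha> \<Longrightarrow> g x = f x" "\<And>x. a \<le> g x" "\<And>x. g x \<le> b"
proof -
  obtain g where g: "continuous_map euclidean euclideanreal g"
    "\<And>x. x \<in> essential_points \<alpha> \<Longrightarrow> g x = f x" "g ` topspace euclidean \<subseteq> {a..b}"
  proof (rule Tietze_extension_closed_real_interval[OF compact_space_normal[OF compact_UNIV], of "essential_points \<alpha>" f a b])
    show "f ` essential_points \<alpha> \<subseteq> {a..b}" using assms(2) by auto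
  qed (use closed_essential_points assms(1,3) in auto)
  from g(1,3) have "continuous_on UNIV g" "\<And>x. a \<le> g x \<and> g x \<le> b"
    by (auto simp: image_subset_iff)
  with g(2) that show thesis by blast
qed

text \<open>The entropy is compared with every real b at or above the integral, which also covers
  the value -\<infinity>.\<close>

lemma t_entropy_le:
  assumes \<mu>: "\<mu> \<in> invariant_measures \<alpha>" and cont: "continuous_on (essential_points \<alpha>) (cocycle \<alpha> A)"
    and sheets: "finite_sheeted_on_essential \<alpha>" and rate: "inverse_rami_rate \<alpha> = 0"
    and compat: "essentially_compatible \<alpha> A"
  shows "t_entropy A \<mu> \<le> log_integral \<mu> extended_cocycle"
proof (rule ereal_le_real)
  fix b assume "log_integral \<mu> extended_cocycle \<le> ereal b"
  show "t_entropy A \<mu> \<le> ereal b"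
  proof (rule ereal_le_epsilon2)
    fix \<kappa> :: real assume "0 < \<kappa>"
    \<comment> \<open>Four errors of size k arise per step: from truncating ln rho, from the
      oscillation on the members of G, from the factor 2 in the bound on F, and from ln(1 + k) \<le>
      k.\<close>
    define k where "k = \<kappa> / 4"
    have k: "0 < k" using \<open>0 < \<kappa>\<close> by (simp add: k_def)
    note inv = invariant_measuresD[OF \<mu>]
    interpret prob_space \<mu> by (rule inv)
    define r where "r = extended_cocycle"
    have meas: "r \<in> borel_measurable \<mu>"
      using extended_cocycle_measurable[OF cont] regular_borel_measureD(1)[OF inv(1)] measurable_cong_sets
      unfolding r_def by blast
    obtain c where c: "1 \<le> c" "\<And>x. A (\<lambda>x. 1) x \<le> c" "\<And>x. 0 \<le> r x" "\<And>x. r x \<le> c"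
      using extended_cocycle_bounded unfolding r_def by metis
    have "log_integral \<mu> r < ereal (b + k)"
      using \<open>log_integral \<mu> extended_cocycle \<le> ereal b\<close> k unfolding r_def
      by (meson ereal_less_eq less_ereal.simps(1) less_add_same_cancel1 order_le_less_trans)
    then obtain e where e: "0 < e" and J: "(\<integral>x. ln (max (r x) e) \<partial>\<mu>) < b + k"
      using log_integral_less[OF inv(2) meas c(4)] by metis
    obtain N where N: "\<And>x. x \<in> essential_points \<alpha> \<Longrightarrow> finite (essential_preimage \<alpha> 1 x)"
      "\<And>x. x \<in> essential_points \<alpha> \<Longrightarrow> real (card (essential_preimage \<alpha> 1 x)) \<le> N" "0 \<le> N"
      using finite_sheeted_bound[OF sheets] by metis
    have "\<forall>\<^sub>F n in sequentially. ln 2 / real n < k"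
      by (rule order_tendstoD(2)[OF lim_const_over_n k])
    then have "\<forall>\<^sub>F n in sequentially. (\<forall>x\<in>essential_points \<alpha>.
        real (card (essential_preimage \<alpha> n x)) \<le> (1 + k) ^ n) \<and> ln 2 / real n < k \<and> 1 \<le> n"
      using inverse_rami_rate_zero_bound[OF rate k] eventually_ge_at_top[of "1::nat"] by eventually_elim auto
    \<comment> \<open>A single n is enough, since the entropy is an infimum over n; ln 2 / n < k
      absorbs the factor 2 below.\<close>
    then obtain n where n: "\<And>x. x \<in> essential_points \<alpha> \<Longrightarrow> real (card (essential_preimage \<alpha> n x)) \<le> (1 + k) ^ n"
      "ln 2 / real n < k" "1 \<le> n"
      using eventually_happens[of _ sequentially] by (metis (mono_tags, lifting) sequentially_bot)
    define C where "C = c / e"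
    define K where "K = rec_nat 0 (\<lambda>k c. N * c + C ^ k * (1 / e)) n"
    have C: "0 \<le> C" using c e by (simp add: C_def)
    have K: "0 \<le> K" unfolding K_def using C N(3) e by (induction n) auto
    \<comment> \<open>The leak after n steps is K * d; this d, chosen after n, keeps it at most 1
      \<le> (1 + k) ^ n, so the bound at worst doubles.\<close>
    define d where "d = 1 / (K + 1)"
    have d: "0 < d" "K * d \<le> 1" using K by (auto simp: d_def field_simps)
    obtain h where h: "continuous_on UNIV h" "\<And>y. 0 < h y" "\<And>y. h y \<le> 1"
      "\<And>y. y \<in> essential_points \<alpha> \<Longrightarrow> h y = 1"
      "\<And>x. x \<in> essential_points \<alpha> \<Longrightarrow> A h x - measure (operator_measure A x) (essential_points \<alpha>) \<le> d"
      using uniform_cutoff[OF compat d(1)] by metis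
    \<comment> \<open>The bound s \<ge> e is needed on all of X, so that w \<le> h / e and ln w is
      continuous everywhere.\<close>
    obtain s where s: "continuous_on UNIV s" "\<And>x. x \<in> essential_points \<alpha> \<Longrightarrow> s x = max (cocycle \<alpha> A x) e"
      "\<And>x. e \<le> s x"
    proof (rule tietze_essential[of "\<lambda>x. max (cocycle \<alpha> A x) e" e "max c e"])
      show "continuous_on (essential_points \<alpha>) (\<lambda>x. max (cocycle \<alpha> A x) e)"
        by (intro continuous_intros cont)
      show "e \<le> max (cocycle \<alpha> A x) e \<and> max (cocycle \<alpha> A x) e \<le> max c e" if "x \<in> essential_points \<alpha>" for x
        using c(4)[of x] that by (auto simp: r_def extended_cocycle_def)
    qed auto
    have s0: "0 < s x" for x using s(3)[of x] e by linarith
    define w where "w = (\<lambda>x. h x / s x)"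
    have wc: "continuous_on UNIV w"
      unfolding w_def using s0 by (intro continuous_intros h s) (simp add: less_imp_neq[symmetric])
    have w0: "0 < w x" for x using h(2)[of x] s0[of x] by (simp add: w_def)
    have wh: "w x \<le> 1 / e * h x" for x
      unfolding w_def using h(2)[of x] s(3)[of x] e by (simp add: divide_left_mono)
    have we: "w x \<le> 1 / e" for x
      using wh[of x] h(3)[of x] e by (smt (verit) divide_nonneg_pos mult_left_le zero_less_divide_1_iff)
    have w\<rho>: "cocycle \<alpha> A y * w y \<le> 1" if "y \<in> essential_points \<alpha>" for y
      using h(4)[OF that] s(2)[OF that] s0[of y] by (simp add: w_def)
    have Aw: "A w x \<le> C" for x
    proof -
      have "A w x \<le> A (\<lambda>x. 1 / e) x" by (intro A.mono wc we) auto
      also have "\<dots> \<le> C" using A.const[of "1 / e" x] c(2)[of x] e by (simp add: C_def divide_right_mono)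
      finally show ?thesis .
    qed
    define F where "F = ((\<lambda>f. A (\<lambda>x. w x * f x)) ^^ n) (\<lambda>x. 1)"
    have F_le: "F x \<le> 2 * (1 + k) ^ n" if x: "x \<in> essential_points \<alpha>" for x
    proof -
      have "F x \<le> real (card (essential_preimage \<alpha> n x)) + K * d"
        unfolding F_def K_def
        by (rule weighted_iterate_le_card[OF N(1,2) wc less_imp_le[OF w0] wh w\<rho> h(1,4,5) Aw C _ N(3) _ x])
          (use e d in auto)
      also have "\<dots> \<le> (1 + k) ^ n + 1" using n(1)[OF x] d(2) by simp
      also have "\<dots> \<le> 2 * (1 + k) ^ n" using k by (simp add: one_le_power)
      finally show ?thesis .
    qed
    define \<psi> where "\<psi> = (\<lambda>x. \<Sum>i<n. - ln (w ((\<alpha> ^^ i) x)))"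
    have lnw: "continuous_on UNIV (\<lambda>x. - ln (w x))"
      using w0 by (intro continuous_intros wc) (simp add: less_imp_neq[symmetric])
    have lnwi: "continuous_on UNIV (\<lambda>x. - ln (w ((\<alpha> ^^ i) x)))" for i
      using continuous_on_compose2[OF lnw funpow_continuous[OF continuous_\<alpha>]] by simp
    have \<psi>c: "continuous_on UNIV \<psi>" unfolding \<psi>_def by (intro continuous_on_sum lnwi)
    have exp_\<psi>: "(\<lambda>x. exp (- \<psi> x)) = (\<lambda>x. (\<Prod>i<n. w ((\<alpha> ^^ i) x)) * 1)"
      using w0 by (simp add: \<psi>_def exp_sum sum_negf fun_eq_iff)
    have AF: "(A ^^ n) (\<lambda>x. exp (- \<psi> x)) = F"
      unfolding exp_\<psi> F_def by (rule iterate_weighted[OF wc]) auto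
    have Fc: "continuous_on UNIV F"
      unfolding AF[symmetric] by (intro iterate_continuous continuous_intros \<psi>c)
    have "integral\<^sup>L \<mu> ((A ^^ n) (\<lambda>x. exp (- \<psi> x))) \<le> (\<integral>x. 2 * (1 + k) ^ n \<partial>\<mu>)"
      unfolding AF using AE_essential_points[OF \<mu>] F_le
      by (intro integral_mono_AE integrable_continuous_compact[OF compact_UNIV inv(1) Fc]) (auto elim: eventually_mono)
    then have z: "integral\<^sup>L \<mu> ((A ^^ n) (\<lambda>x. exp (- \<psi> x))) \<le> 2 * (1 + k) ^ n"
      by (simp add: prob_space)
    have z0: "0 < 2 * (1 + k) ^ n" using k by simp
    have nk: "0 < real n * k" using n k by simp
    obtain G where G: "G \<in> partitions_of_unity"
      "partition_entropy (\<lambda>f. integral\<^sup>L \<mu> ((A ^^ n) f)) \<mu> G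
        \<le> ereal (integral\<^sup>L \<mu> \<psi> + real n * k + ln (2 * (1 + k) ^ n))"
      using partition_entropy_upper[OF compact_UNIV inv(1,2) positive_functional_iterate[OF inv(1)] \<psi>c z z0 nk]
      by metis
    have "(\<integral>x. - ln (w x) \<partial>\<mu>) = (\<integral>x. ln (max (r x) e) \<partial>\<mu>)"
    proof (rule integral_cong_AE)
      show "(\<lambda>x. ln (max (r x) e)) \<in> borel_measurable \<mu>" using meas by simp
      show "AE x in \<mu>. - ln (w x) = ln (max (r x) e)"
        using AE_essential_points[OF \<mu>]
        by eventually_elim (use s0 in \<open>simp add: w_def h(4) s(2) r_def extended_cocycle_def ln_div e less_max_iff_disj\<close>)
    qed (rule measurable_continuous_regular[OF inv(1) lnw])
    moreover have "integral\<^sup>L \<mu> \<psi> = (\<Sum>i<n. \<integral>x. - ln (w ((\<alpha> ^^ i) x)) \<partial>\<mu>)"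
      unfolding \<psi>_def
      by (intro Bochner_Integration.integral_sum integrable_continuous_compact[OF compact_UNIV inv(1) lnwi])
    ultimately have "integral\<^sup>L \<mu> \<psi> = real n * (\<integral>x. ln (max (r x) e) \<partial>\<mu>)"
      unfolding invariant_funpow(1)[OF \<mu> continuous_\<alpha> borel_measurable_continuous_onI[OF lnw]] by simp
    also have "\<dots> \<le> real n * (b + k)" using J by (intro mult_left_mono) auto
    finally have \<psi>_le: "integral\<^sup>L \<mu> \<psi> \<le> real n * (b + k)" .
    have "ln (2 * (1 + k) ^ n) = ln 2 + real n * ln (1 + k)"
      using k by (simp add: ln_mult ln_realpow)
    also have "\<dots> \<le> real n * k + real n * k"
      using n(2,3) k ln_add_one_self_le_self[of k] by (intro add_mono mult_left_mono) (auto simp: field_simps)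
    finally have total: "integral\<^sup>L \<mu> \<psi> + real n * k + ln (2 * (1 + k) ^ n) \<le> real n * (b + \<kappa>)"
      using \<psi>_le by (simp add: k_def algebra_simps)
    have "t_entropy A \<mu> \<le> ereal (1 / real n) *
        (INF G\<in>partitions_of_unity. partition_entropy (\<lambda>f. integral\<^sup>L \<mu> ((A ^^ n) f)) \<mu> G)"
      unfolding t_entropy_eq using n(3) by (intro INF_lower) auto
    also have "\<dots> \<le> ereal (1 / real n) * ereal (real n * (b + \<kappa>))"
    proof (intro ereal_mult_left_mono INF_lower2[OF G(1)])
      show "partition_entropy (\<lambda>f. integral\<^sup>L \<mu> ((A ^^ n) f)) \<mu> G \<le> ereal (real n * (b + \<kappa>))"
        using G(2) total by (meson ereal_less_eq(3) order_trans)
    qed simp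
    also have "\<dots> = ereal b + ereal \<kappa>" using n(3) by simp
    finally show "t_entropy A \<mu> \<le> ereal b + ereal \<kappa>" .
  qed
qed

section \<open>The case of a homeomorphism on the essential set\<close>

context
  fixes \<beta>
  assumes homeo: "homeomorphism (essential_points \<alpha>) (essential_points \<alpha>) \<alpha> \<beta>"
begin

lemma essential_preimage_homeomorphism:
  assumes "x \<in> essential_points \<alpha>"
  shows "essential_preimage \<alpha> 1 x = {\<beta> x}"
proof -
  have "\<beta> x \<in> essential_points \<alpha>" "\<alpha> (\<beta> x) = x" "\<And>y. y \<in> essential_points \<alpha> \<Longrightarrow> \<beta> (\<alpha> y) = y"
    using homeo assms unfolding homeomorphism_def by auto
  then show ?thesis by (auto simp: essential_preimage_def)
qed

lemma card_essential_preimage_homeomorphism: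
  assumes "x \<in> essential_points \<alpha>"
  shows "finite (essential_preimage \<alpha> n x) \<and> card (essential_preimage \<alpha> n x) = 1"
proof
  have fin: "finite (essential_preimage \<alpha> 1 y)" if "y \<in> essential_points \<alpha>" for y
    unfolding essential_preimage_homeomorphism[OF that] by simp
  then show "finite (essential_preimage \<alpha> n x)"
    by (rule finite_essential_preimage[OF _ assms])
  show "card (essential_preimage \<alpha> n x) = 1"
    using assms
  proof (induction n arbitrary: x)
    case 0
    have "essential_preimage \<alpha> 0 x = {x}" using 0 by (auto simp: essential_preimage_def)
    then show ?case by simp
  next
    case (Suc n)
    have "\<beta> x \<in> essential_points \<alpha>" using homeo Suc.prems unfolding homeomorphism_def by auto
    then show ?case
      using card_essential_preimage_Suc[OF fin Suc.prems, of n] Suc.IH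
      unfolding essential_preimage_homeomorphism[OF Suc.prems] by simp
  qed
qed

text \<open>Every essential point has exactly one n-th essential preimage, so the suprema equal 1
  for n > 0. The index 0 is left out because \<open>root 0\<close> is constantly 0; the limsup does
  not see it.\<close>

lemma inverse_rami_rate_homeomorphism: "inverse_rami_rate \<alpha> = 0"
proof -
  let ?X = "\<lambda>n. SUP x\<in>essential_points \<alpha>. if finite (essential_preimage \<alpha> n x)
        then ereal (root n (real (card (essential_preimage \<alpha> n x)))) else \<infinity>"
  have "?X n = 1" if "0 < n" for n
  proof -
    have "?X n = (SUP x\<in>essential_points \<alpha>. 1)"
      using card_essential_preimage_homeomorphism that by (intro SUP_cong) (auto simp: one_ereal_def)
    then show ?thesis using essential_points_nonempty[OF compact_UNIV continuous_\<alpha>] by simp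
  qed
  then have "limsup ?X = limsup (\<lambda>n. 1)"
    by (intro Limsup_eq eventually_mono[OF eventually_gt_at_top[of 0]]) auto
  then have "limsup ?X = ereal 1" by (simp add: Limsup_const one_ereal_def)
  then show ?thesis unfolding inverse_rami_rate_def by (simp add: eln_ereal zero_ereal_def)
qed

text \<open>y is the only essential preimage of \<open>\<alpha> y\<close>, so rho(y) is the mass
  that the measure attached to \<open>\<alpha> y\<close> gives to the essential set; compatibility
  for the constant 1, composed with \<alpha>, makes this continuous.\<close>

lemma continuous_cocycle_homeomorphism:
  assumes "essentially_compatible \<alpha> A"
  shows "continuous_on (essential_points \<alpha>) (cocycle \<alpha> A)"
proof -
  let ?m = "\<lambda>x. set_lebesgue_integral (operator_measure A x) (essential_points \<alpha>) (\<lambda>y. 1 :: real)"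
  have "continuous_on (essential_points \<alpha>) ?m"
    using assms unfolding essentially_compatible_def by (metis continuous_on_const)
  then have "continuous_on (essential_points \<alpha>) (\<lambda>y. ?m (\<alpha> y))"
    by (rule continuous_on_compose2[OF _ continuous_on_subset[OF continuous_\<alpha>]])
      (auto intro: essential_points_forward[OF continuous_\<alpha>])
  moreover have "?m (\<alpha> y) = cocycle \<alpha> A y" if y: "y \<in> essential_points \<alpha>" for y
  proof -
    have "\<alpha> y \<in> essential_points \<alpha>" "\<beta> (\<alpha> y) = y"
      using homeo y unfolding homeomorphism_def by auto
    then show ?thesis
      using set_integral_operator_measure[of "\<lambda>y. 1" "\<alpha> y"] essential_preimage_homeomorphism[of "\<alpha> y"] by simp
  qed
  ultimately show ?thesis by (simp cong: continuous_on_cong)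
qed

end

end

theorem theorem33:
  fixes \<alpha> :: "'a::t2_space \<Rightarrow> 'a"
    and A :: "('a \<Rightarrow> real) \<Rightarrow> ('a \<Rightarrow> real)"
  assumes "compact (UNIV :: 'a set)"
    and "continuous_on UNIV \<alpha>"
    and "finite_sheeted_on_essential \<alpha>"
    and "transfer_operator \<alpha> A"
    and "essentially_compatible \<alpha> A"
  shows "(inverse_rami_rate \<alpha> = 0 \<and> continuous_on (essential_points \<alpha>) (cocycle \<alpha> A) \<longrightarrow>
            (\<forall>\<mu>\<in>invariant_measures \<alpha>.
               t_entropy A \<mu> =
                 extended_set_integral \<mu> (essential_points \<alpha>) (\<lambda>x. eln (ereal (cocycle \<alpha> A x))))) \<and>
         ((\<exists>\<beta>. homeomorphism (essential_points \<alpha>) (essential_points \<alpha>) \<alpha> \<beta>) \<longrightarrow>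
            inverse_rami_rate \<alpha> = 0 \<and> continuous_on (essential_points \<alpha>) (cocycle \<alpha> A))"
proof -
  interpret compact_transfer_operator \<alpha> A
    using assms(1,2,4) by unfold_locales
  show ?thesis
    using t_entropy_ge t_entropy_le[OF _ _ assms(3) _ assms(5)] extended_set_integral_cocycle
      inverse_rami_rate_homeomorphism continuous_cocycle_homeomorphism[OF _ assms(5)]
    by (auto intro!: antisym)
qed

end
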